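(* Fix $p,q\ge1$ and $\lambda>0$. For Gaussian mixtures $\mu=\sum_{i=1}^{K}a_i\mu_i$ on $\mathbb{R}^d$ and $\nu=\sum_{j=1}^{L}b_j\nu_j$ on $\mathbb{R}^{d'}$ (with $a_i,b_j>0$, $\sum_i a_i=\sum_j b_j=1$, $\mu_i,\nu_j$ Gaussian probability measures, and the components pairwise distinct within each mixture), the partial mixture Gromov--Wasserstein distance $\mathrm{MGW}^{\lambda}_{p,q}(\mu,\nu)$ has the following properties. (i) $\mathrm{MGW}^{\lambda}_{p,q}$ admits a minimizer, i.e. the infimum in its definition over partial couplings is attained. (ii) $\mathrm{MGW}^{\lambda}_{p,q}$ defines a metric on the associated component metric measure spaces $(\mathcal G_\mu,W_2,\alpha_\mu)$ modulo strong isomorphism. (iii) If $$\lambda\ge\max_{\substack{1\le i,k\le K\\ 1\le j,l\le L}}\left|W_2(\mu_i,\mu_k)^q-W_2(\nu_j,\nu_l)^q\right|^p,$$ then $\mathrm{MGW}^{\lambda}_{p,q}(\mu,\nu)=\mathrm{MGW}_{p,q}(\mu,\nu)$, the balanced mixture Gromov--Wasserstein distance. In particular, $\mathrm{MGW}^{\lambda}_{p,q}(\mu,\nu)\to\mathrm{MGW}_{p,q}(\mu,\nu)$ as $\lambda\to\infty$.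
   Context: $W_2$ is the $2$-Wasserstein distance. The component space of $\mu$ is the finite set $\mathcal G_\mu=\{\mu_1,\dots,\mu_K\}$ with the restricted distance $W_2$ and the probability measure $\alpha_\mu=\sum_{i=1}^{K}a_i\delta_{\mu_i}$; similarly $\mathcal G_\nu=\{\nu_1,\dots,\nu_L\}$ and $\alpha_\nu=\sum_{j=1}^{L}b_j\delta_{\nu_j}$. For metric measure spaces $(\mathcal X,d_{\mathcal X},\mu)$ and $(\mathcal Y,d_{\mathcal Y},\nu)$, let $\Pi(\mu,\nu)$ be the set of couplings and $\Pi_{\le}(\mu,\nu)$ the set of nonnegative finite Borel measures $\gamma$ on $\mathcal X\times\mathcal Y$ with first marginal $\le\mu$ and second marginal $\le\nu$. The partial Gromov--Wasserstein distance $\mathrm{GW}^{\lambda}_{p,q}$ is the $p$-th root of $$\inf_{\gamma\in\Pi_{\le}(\mu,\nu)}\left\{\int_{(\mathcal X\times\mathcal Y)^2}\left(|d_{\mathcal X}(x,x')^q-d_{\mathcal Y}(y,y')^q|^p-2\lambda\right)\mathrm{d}\gamma(x,y)\,\mathrm{d}\gamma(x',y')+\lambda(|\mu|^2+|\nu|^2)\right\},$$ where $|\cdot|$ is total mass, and the balanced distance $\mathrm{GW}_{p,q}$ is the $p$-th root of $$\inf_{\gamma\in\Pi(\mu,\nu)}\int_{(\mathcal X\times\mathcal Y)^2}|d_{\mathcal X}(x,x')^q-d_{\mathcal Y}(y,y')^q|^p\,\mathrm{d}\gamma(x,y)\,\mathrm{d}\gamma(x',y').$$ The partial and balanced mixture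 Gromov--Wasserstein distances are $$\mathrm{MGW}^{\lambda}_{p,q}(\mu,\nu)=\mathrm{GW}^{\lambda}_{p,q}\bigl((\mathcal G_\mu,W_2,\alpha_\mu),(\mathcal G_\nu,W_2,\alpha_\nu)\bigr),\qquad \mathrm{MGW}_{p,q}(\mu,\nu)=\mathrm{GW}_{p,q}\bigl((\mathcal G_\mu,W_2,\alpha_\mu),(\mathcal G_\nu,W_2,\alpha_\nu)\bigr).$$ Equivalently, $$\left(\mathrm{MGW}^{\lambda}_{p,q}(\mu,\nu)\right)^p=\min_{\omega}\left\{\sum_{i,k=1}^{K}\sum_{j,l=1}^{L}\left(\left|W_2(\mu_i,\mu_k)^q-W_2(\nu_j,\nu_l)^q\right|^p-2\lambda\right)\omega_{ij}\omega_{kl}+2\lambda\right\},$$ over nonnegative $K\times L$ matrices $\omega$ with row sums $\le a=(a_1,\dots,a_K)$ and column sums $\le b=(b_1,\dots,b_L)$ componentwise. Two (fully supported) metric measure spaces are strongly isomorphic if there is a bijective isometry between them pushing one measure forward to the other. "Defines a metric modulo strong isomorphism" means: nonnegative, symmetric, satisfies the triangle inequality, and vanishes exactly when the two component spaces are strongly isomorphic. *)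

theory Defs
  imports "HOL-Probability.Probability"
begin

text \<open>
  Since \<open>fst\<close> and \<open>snd\<close> are pushed forward to the \<open>\<sigma>\<close>-algebras of \<open>M\<close> and \<open>N\<close>, the marginals are
  compared with \<open>M\<close> and \<open>N\<close> as measures on the same \<open>\<sigma>\<close>-algebra; there \<open>\<le>\<close> on measures is setwise.
  For separable metric spaces with their Borel sets, the product \<open>\<sigma>\<close>-algebra consists of the
  Borel sets of the product space.
\<close>

definition couplings :: "'a measure \<Rightarrow> 'b measure \<Rightarrow> ('a \<times> 'b) measure set" where
  "couplings M N =
     {\<gamma>. sets \<gamma> = sets (M \<Otimes>\<^sub>M N) \<and> distr \<gamma> M fst = M \<and> distr \<gamma> N snd = N}"

definition partial_couplings :: "'a measure \<Rightarrow> 'b measure \<Rightarrow> ('a \<times> 'b) measure set" where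
  "partial_couplings M N =
     {\<gamma>. sets \<gamma> = sets (M \<Otimes>\<^sub>M N) \<and> finite_measure \<gamma> \<and> distr \<gamma> M fst \<le> M \<and> distr \<gamma> N snd \<le> N}"

text \<open>
  The infimum is taken in the extended reals; it is finite whenever both measures have finite
  second moments, in particular for Gaussian measures.
\<close>

definition W2 :: "'a::euclidean_space measure \<Rightarrow> 'a measure \<Rightarrow> real" where
  "W2 M N = sqrt (enn2real
     (INF \<pi>\<in>couplings M N. \<integral>\<^sup>+ (x, y). ennreal ((dist x y)\<^sup>2) \<partial>\<pi>))"

text \<open>
  A metric measure space \<open>(X, d, M)\<close> is passed as the pair of arguments \<open>d\<close>, \<open>M\<close>, with
  \<open>X = space M\<close>. The objectives use the Bochner integral and real infima, so they are meant for
  bounded metric measure spaces of finite mass (here: finite spaces), where the integrands are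
  bounded.
\<close>

definition gw_cost ::
  "real \<Rightarrow> real \<Rightarrow> ('a \<Rightarrow> 'a \<Rightarrow> real) \<Rightarrow> ('b \<Rightarrow> 'b \<Rightarrow> real) \<Rightarrow> 'a \<times> 'b \<Rightarrow> 'a \<times> 'b \<Rightarrow> real" where
  "gw_cost p q dX dY = (\<lambda>(x, y) (x', y'). \<bar>dX x x' powr q - dY y y' powr q\<bar> powr p)"

definition pgw_objective ::
  "real \<Rightarrow> real \<Rightarrow> real \<Rightarrow> ('a \<Rightarrow> 'a \<Rightarrow> real) \<Rightarrow> 'a measure \<Rightarrow> ('b \<Rightarrow> 'b \<Rightarrow> real) \<Rightarrow> 'b measure
     \<Rightarrow> ('a \<times> 'b) measure \<Rightarrow> real" where
  "pgw_objective lam p q dX M dY N \<gamma> =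
     (\<integral>(z, z'). (gw_cost p q dX dY z z' - 2 * lam) \<partial>(\<gamma> \<Otimes>\<^sub>M \<gamma>))
     + lam * ((measure M (space M))\<^sup>2 + (measure N (space N))\<^sup>2)"

definition PGW ::
  "real \<Rightarrow> real \<Rightarrow> real \<Rightarrow> ('a \<Rightarrow> 'a \<Rightarrow> real) \<Rightarrow> 'a measure \<Rightarrow> ('b \<Rightarrow> 'b \<Rightarrow> real) \<Rightarrow> 'b measure \<Rightarrow> real"
where
  "PGW lam p q dX M dY N =
     (INF \<gamma>\<in>partial_couplings M N. pgw_objective lam p q dX M dY N \<gamma>) powr (1 / p)"

definition gw_objective ::
  "real \<Rightarrow> real \<Rightarrow> ('a \<Rightarrow> 'a \<Rightarrow> real) \<Rightarrow> ('b \<Rightarrow> 'b \<Rightarrow> real) \<Rightarrow> ('a \<times> 'b) measure \<Rightarrow> real" where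
  "gw_objective p q dX dY \<gamma> = (\<integral>(z, z'). gw_cost p q dX dY z z' \<partial>(\<gamma> \<Otimes>\<^sub>M \<gamma>))"

definition GW ::
  "real \<Rightarrow> real \<Rightarrow> ('a \<Rightarrow> 'a \<Rightarrow> real) \<Rightarrow> 'a measure \<Rightarrow> ('b \<Rightarrow> 'b \<Rightarrow> real) \<Rightarrow> 'b measure \<Rightarrow> real"
where
  "GW p q dX M dY N = (INF \<gamma>\<in>couplings M N. gw_objective p q dX dY \<gamma>) powr (1 / p)"

definition strongly_isomorphic ::
  "('a \<Rightarrow> 'a \<Rightarrow> real) \<Rightarrow> 'a measure \<Rightarrow> ('b \<Rightarrow> 'b \<Rightarrow> real) \<Rightarrow> 'b measure \<Rightarrow> bool" where
  "strongly_isomorphic dX M dY N \<longleftrightarrow>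
     (\<exists>f\<in>measurable M N. bij_betw f (space M) (space N)
        \<and> (\<forall>x\<in>space M. \<forall>x'\<in>space M. dY (f x) (f x') = dX x x')
        \<and> distr M N f = N)"

text \<open>
  Gaussian measures may be degenerate: each one-dimensional projection is either a normal
  distribution or a Dirac measure (a normal distribution of variance zero).
\<close>

definition gaussian_measure :: "'a::euclidean_space measure \<Rightarrow> bool" where
  "gaussian_measure M \<longleftrightarrow> prob_space M \<and> sets M = sets borel \<and>
     (\<forall>u. (\<exists>m \<sigma>. 0 < \<sigma> \<and> distr M borel (\<lambda>x. x \<bullet> u) = density lborel (normal_density m \<sigma>))
        \<or> (\<exists>m. distr M borel (\<lambda>x. x \<bullet> u) = return borel m))"

text \<open>
  A mixture \<open>\<mu> = (\<Sum>i<K. a\<^sub>i \<mu>\<^sub>i)\<close> is represented by its decomposition, since the component space is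
  defined from it; only indices below \<open>ncomps \<mu>\<close> are relevant.
\<close>

record 'a mixture =
  ncomps :: nat
  weight :: "nat \<Rightarrow> real"
  component :: "nat \<Rightarrow> 'a measure"

definition gaussian_mixture :: "'a::euclidean_space mixture \<Rightarrow> bool" where
  "gaussian_mixture \<mu> \<longleftrightarrow>
     (\<forall>i<ncomps \<mu>. 0 < weight \<mu> i) \<and> (\<Sum>i<ncomps \<mu>. weight \<mu> i) = 1
     \<and> (\<forall>i<ncomps \<mu>. gaussian_measure (component \<mu> i))
     \<and> inj_on (component \<mu>) {..<ncomps \<mu>}"

definition component_space :: "'a mixture \<Rightarrow> 'a measure set" where
  "component_space \<mu> = component \<mu> ` {..<ncomps \<mu>}"

text \<open>\<open>\<Sum>i<K. a\<^sub>i \<delta>\<^bsub>\<mu>\<^sub>i\<^esub>\<close>; every subset of the finite metric space of components is Borel.\<close>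

definition component_measure :: "'a mixture \<Rightarrow> 'a measure measure" where
  "component_measure \<mu> = measure_of (component_space \<mu>) (Pow (component_space \<mu>))
     (\<lambda>A. \<Sum>i<ncomps \<mu>. ennreal (weight \<mu> i) * indicator A (component \<mu> i))"

definition PMGW ::
  "real \<Rightarrow> real \<Rightarrow> real \<Rightarrow> 'a::euclidean_space mixture \<Rightarrow> 'b::euclidean_space mixture \<Rightarrow> real" where
  "PMGW lam p q \<mu> \<nu> = PGW lam p q W2 (component_measure \<mu>) W2 (component_measure \<nu>)"

definition MGW ::
  "real \<Rightarrow> real \<Rightarrow> 'a::euclidean_space mixture \<Rightarrow> 'b::euclidean_space mixture \<Rightarrow> real" where
  "MGW p q \<mu> \<nu> = GW p q W2 (component_measure \<mu>) W2 (component_measure \<nu>)"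

end

theory Submission imports Defs begin

text \<open>
  On finite spaces a partial coupling is a nonnegative matrix, so a minimizer exists by compactness
  and all remaining claims become statements about finite sums.

  The delicate point is the triangle inequality. Adjoining a cemetery point to each space turns
  partial couplings into balanced ones, with cost \<open>\<lambda>\<close> whenever exactly one of two pairs involves the
  cemetery. This extended gap is not a metric: \<open>|s - u|\<close> may exceed \<open>2 \<lambda>^(1/p)\<close>, the length of the
  detour through the cemetery. If the two partial couplings have masses \<open>m\<close>, \<open>n\<close> with \<open>m + n \<ge> 1\<close>, the
  freedom in gluing over the cemetery point suffices to avoid such detours, and Minkowski's inequality
  applies. If \<open>m + n < 1\<close>, then \<open>m\<^sup>2 + n\<^sup>2 \<le> 1\<close>, so the unmatched mass alone costs
  \<open>2 \<lambda> (2 - m\<^sup>2 - n\<^sup>2) \<ge> 2 \<lambda>\<close>, and \<open>2 \<lambda>\<close> is the cost of the empty coupling.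

  If \<open>\<lambda>\<close> dominates the costs, completing a partial coupling to a balanced one does not increase the
  objective, since its integrand is nonpositive. At value zero the coupling is balanced and the
  integrand vanishes on its support; as \<open>W\<^sub>2\<close> separates Gaussian measures, the support is the
  graph of an isometric bijection.
\<close>

subsection \<open>Minkowski's inequality for finite sums\<close>

text \<open>The convexity fact \<open>powr_convex\<close> is applied only when both points are
  positive. If one of them vanishes, the claim reduces to \<open>s powr p \<le> s\<close> on the
  unit interval.\<close>

lemma powr_convex_combination_le:
  fixes x y t p :: real
  assumes "0 \<le> x" "0 \<le> y" "0 \<le> t" "t \<le> 1" "1 \<le> p"
  shows "((1 - t) * x + t * y) powr p \<le> (1 - t) * x powr p + t * y powr p"
proof -
  have *: "s powr p \<le> s" if "0 \<le> s" "s \<le> 1" for s :: real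
    using powr_mono'[of 1 p s] that assms by (cases "s = 0") auto
  show ?thesis
  proof (cases "x = 0 \<or> y = 0")
    case True
    with *[of t] *[of "1 - t"] assms show ?thesis
      by (auto simp: powr_mult intro!: mult_right_mono)
  next
    case False
    with convex_onD[OF powr_convex[OF \<open>1 \<le> p\<close>], of t x y] assms show ?thesis
      by simp
  qed
qed

text \<open>After division by \<open>(x + y) powr p\<close> two fractions with sum 1 remain, and
  raising them to a power \<open>p \<ge> 1\<close> can only shrink them.\<close>

lemma powr_add_superadditive:
  fixes x y p :: real
  assumes "0 \<le> x" "0 \<le> y" "1 \<le> p"
  shows "x powr p + y powr p \<le> (x + y) powr p"
proof (cases "x + y = 0")
  case False
  then have pos: "0 < x + y" using assms by linarith
  have *: "s powr p \<le> s" if "0 \<le> s" "s \<le> 1" for s :: real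
    using powr_mono'[of 1 p s] that assms by (cases "s = 0") auto
  have "(x / (x + y)) powr p + (y / (x + y)) powr p \<le> x / (x + y) + y / (x + y)"
    using pos assms by (intro add_mono *) (auto simp: divide_simps)
  also have "\<dots> = 1" using pos by (simp flip: add_divide_distrib)
  finally have "(x powr p + y powr p) / (x + y) powr p \<le> 1"
    using pos assms by (simp add: powr_divide add_divide_distrib)
  then show ?thesis using pos by (simp add: divide_simps)
qed (use assms in \<open>auto simp: add_nonneg_eq_0_iff\<close>)

text \<open>Superadditivity of the \<open>p\<close>-th power, applied to the \<open>p\<close>-th
  roots. It splits the root of a sum of two costs when the couplings have small mass.\<close>

lemma powr_inverse_subadditive:
  fixes x y p :: real
  assumes "0 \<le> x" "0 \<le> y" "1 \<le> p"
  shows "(x + y) powr (1 / p) \<le> x powr (1 / p) + y powr (1 / p)"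
proof -
  have "x + y = (x powr (1 / p)) powr p + (y powr (1 / p)) powr p"
    using assms by (simp add: powr_powr)
  also have "\<dots> \<le> (x powr (1 / p) + y powr (1 / p)) powr p"
    by (rule powr_add_superadditive) (use assms in auto)
  finally have "(x + y) powr (1 / p) \<le> ((x powr (1 / p) + y powr (1 / p)) powr p) powr (1 / p)"
    using assms by (intro powr_mono2) auto
  also have "\<dots> = x powr (1 / p) + y powr (1 / p)"
    using assms by (simp add: powr_powr)
  finally show ?thesis .
qed

text \<open>The pointwise inequality is demanded only where the weight is nonzero, so a gluing may
  violate it at points that carry no mass. The proof normalizes both functions and uses convexity of
  the power.\<close>

lemma minkowski_sum:
  fixes f g h w :: "'i \<Rightarrow> real"
  assumes p: "1 \<le> p"
    and nonneg: "\<And>i. i \<in> I \<Longrightarrow> 0 \<le> w i" "\<And>i. i \<in> I \<Longrightarrow> 0 \<le> f i" "\<And>i. i \<in> I \<Longrightarrow> 0 \<le> g i"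
      "\<And>i. i \<in> I \<Longrightarrow> 0 \<le> h i"
    and le: "\<And>i. i \<in> I \<Longrightarrow> w i \<noteq> 0 \<Longrightarrow> h i \<le> f i + g i"
  shows "(\<Sum>i\<in>I. w i * h i powr p) powr (1 / p)
    \<le> (\<Sum>i\<in>I. w i * f i powr p) powr (1 / p) + (\<Sum>i\<in>I. w i * g i powr p) powr (1 / p)"
proof (cases "finite I")
  case fin: True
  define A where "A = (\<Sum>i\<in>I. w i * f i powr p) powr (1 / p)"
  define B where "B = (\<Sum>i\<in>I. w i * g i powr p) powr (1 / p)"
  have sums: "(\<Sum>i\<in>I. w i * f i powr p) = A powr p" "(\<Sum>i\<in>I. w i * g i powr p) = B powr p"
    unfolding A_def B_def using p nonneg by (simp_all add: powr_powr sum_nonneg)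
  have AB: "0 \<le> A" "0 \<le> B" unfolding A_def B_def by auto
  text \<open>Working with \<open>A + e\<close>, \<open>B + e\<close> avoids the degenerate cases \<open>A = 0\<close> and \<open>B = 0\<close>.\<close>
  have bound: "(\<Sum>i\<in>I. w i * h i powr p) powr (1 / p) \<le> (A + e) + (B + e)" if e: "0 < e" for e
  proof -
    define A' B' where "A' = A + e" and "B' = B + e"
    have pos: "0 < A'" "0 < B'" "0 < A' + B'" using AB e by (auto simp: A'_def B'_def)
    \<comment> \<open>With this weight, \<open>(f i + g i) / (A' + B')\<close> is a convex
      combination of \<open>f i / A'\<close> and \<open>g i / B'\<close>.\<close>
    define t where "t = B' / (A' + B')"
    have t: "0 \<le> t" "t \<le> 1" "1 - t = A' / (A' + B')" using pos by (auto simp: t_def field_simps)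
    have ineq: "w i * h i powr p
      \<le> (A' + B') powr p * ((1 - t) * (w i * f i powr p) / A' powr p + t * (w i * g i powr p) / B' powr p)"
      if i: "i \<in> I" for i
    proof (cases "w i = 0")
      case False
      have eq: "f i + g i = (A' + B') * ((1 - t) * (f i / A') + t * (g i / B'))"
      proof -
        have "(A' + B') * (1 - t) = A'" "(A' + B') * t = B'"
          unfolding t(3) using pos by (auto simp: t_def)
        then show ?thesis using pos by (simp add: distrib_left flip: mult.assoc)
      qed
      have "h i powr p \<le> (f i + g i) powr p"
        using le[OF i False] nonneg[OF i] p by (intro powr_mono2) auto
      also have "\<dots> = (A' + B') powr p * ((1 - t) * (f i / A') + t * (g i / B')) powr p"
        unfolding eq using pos t nonneg[OF i] by (intro powr_mult) 
      also have "\<dots> \<le> (A' + B') powr p * ((1 - t) * (f i / A') powr p + t * (g i / B') powr p)"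
        using nonneg[OF i] pos t p by (intro mult_left_mono powr_convex_combination_le) auto
      also have "\<dots> = (A' + B') powr p * ((1 - t) * f i powr p / A' powr p + t * g i powr p / B' powr p)"
        using nonneg[OF i] pos by (simp add: powr_divide)
      finally have "w i * h i powr p \<le> w i * \<dots>" by (rule mult_left_mono) (rule nonneg[OF i])
      then show ?thesis by (simp add: algebra_simps)
    qed simp
    have "(\<Sum>i\<in>I. w i * h i powr p) \<le>
      (\<Sum>i\<in>I. (A' + B') powr p * ((1 - t) * (w i * f i powr p) / A' powr p + t * (w i * g i powr p) / B' powr p))"
      by (rule sum_mono) (rule ineq)
    also have "\<dots> = (A' + B') powr p * ((1 - t) * (A powr p / A' powr p) + t * (B powr p / B' powr p))"
      by (simp add: sum.distrib sum_distrib_left[symmetric] sum_divide_distrib[symmetric] flip: sums)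
    \<comment> \<open>Both normalized sums are at most 1, because \<open>A \<le> A'\<close> and
      \<open>B \<le> B'\<close>.\<close>
    also have "\<dots> \<le> (A' + B') powr p * ((1 - t) * 1 + t * 1)"
      using pos AB t p e
      by (intro mult_left_mono add_mono) (auto simp: divide_simps A'_def B'_def intro!: powr_mono2)
    finally have "(\<Sum>i\<in>I. w i * h i powr p) powr (1 / p) \<le> ((A' + B') powr p) powr (1 / p)"
      using p nonneg by (intro powr_mono2) (auto intro!: sum_nonneg)
    then show ?thesis using pos p by (simp add: powr_powr A'_def B'_def)
  qed
  show ?thesis
    unfolding A_def[symmetric] B_def[symmetric]
  proof (rule field_le_epsilon)
    fix e :: real assume "0 < e"
    with bound[of "e / 2"] show "(\<Sum>i\<in>I. w i * h i powr p) powr (1 / p) \<le> A + B + e" by simp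
  qed
qed simp

subsection \<open>Partial couplings as matrices\<close>

definition sub_coupling :: "'a set \<Rightarrow> ('a \<Rightarrow> real) \<Rightarrow> 'b set \<Rightarrow> ('b \<Rightarrow> real) \<Rightarrow> ('a \<times> 'b \<Rightarrow> real) \<Rightarrow> bool"
where
  "sub_coupling S a T b w \<longleftrightarrow> (\<forall>z\<in>S \<times> T. 0 \<le> w z)
     \<and> (\<forall>x\<in>S. (\<Sum>y\<in>T. w (x, y)) \<le> a x) \<and> (\<forall>y\<in>T. (\<Sum>x\<in>S. w (x, y)) \<le> b y)"

text \<open>Here \<open>\<delta>\<close> and \<open>\<epsilon>\<close> stand for the
  \<open>q\<close>-th powers of the distances. They may be arbitrary real functions, since only the
  absolute value on the reals enters the triangle inequality. The constant \<open>2 * lam\<close> is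
  the mass term for two probability measures.\<close>

definition pgw_sum ::
  "real \<Rightarrow> real \<Rightarrow> ('a \<Rightarrow> 'a \<Rightarrow> real) \<Rightarrow> 'a set \<Rightarrow> ('b \<Rightarrow> 'b \<Rightarrow> real) \<Rightarrow> 'b set \<Rightarrow> ('a \<times> 'b \<Rightarrow> real) \<Rightarrow> real"
where
  "pgw_sum lam p \<delta> S \<epsilon> T w =
     (\<Sum>z\<in>S \<times> T. \<Sum>z'\<in>S \<times> T.
        (\<bar>\<delta> (fst z) (fst z') - \<epsilon> (snd z) (snd z')\<bar> powr p - 2 * lam) * (w z * w z')) + 2 * lam"

lemma sub_couplingD:
  assumes "sub_coupling S a T b w"
  shows "\<And>x y. x \<in> S \<Longrightarrow> y \<in> T \<Longrightarrow> 0 \<le> w (x, y)"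
    and "\<And>x. x \<in> S \<Longrightarrow> (\<Sum>y\<in>T. w (x, y)) \<le> a x"
    and "\<And>y. y \<in> T \<Longrightarrow> (\<Sum>x\<in>S. w (x, y)) \<le> b y"
  using assms unfolding sub_coupling_def by auto

lemma sub_coupling_mass:
  assumes "sub_coupling S a T b w" and "sum a S = 1"
  shows "0 \<le> sum w (S \<times> T)" and "sum w (S \<times> T) \<le> 1"
proof -
  show "0 \<le> sum w (S \<times> T)"
    using assms unfolding sub_coupling_def by (auto intro!: sum_nonneg)
  have "sum w (S \<times> T) = (\<Sum>x\<in>S. \<Sum>y\<in>T. w (x, y))"
    by (simp add: sum.cartesian_product)
  also have "\<dots> \<le> sum a S"
    using sub_couplingD(2)[OF assms(1)] by (rule sum_mono)
  finally show "sum w (S \<times> T) \<le> 1" using assms by simp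
qed

text \<open>Splits the objective into distortion and a penalty for unmatched mass. For a partial
  coupling of probability measures and \<open>lam \<ge> 0\<close> both parts are
  nonnegative.\<close>

lemma pgw_sum_eq:
  "pgw_sum lam p \<delta> S \<epsilon> T w =
     (\<Sum>z\<in>S \<times> T. \<Sum>z'\<in>S \<times> T. \<bar>\<delta> (fst z) (fst z') - \<epsilon> (snd z) (snd z')\<bar> powr p * (w z * w z'))
     + 2 * lam * (1 - (sum w (S \<times> T))\<^sup>2)"
proof -
  have "(\<Sum>z\<in>S \<times> T. \<Sum>z'\<in>S \<times> T. 2 * lam * (w z * w z')) = 2 * lam * (sum w (S \<times> T))\<^sup>2"
    unfolding power2_eq_square sum_product by (simp only: sum_distrib_left)
  then show ?thesis
    unfolding pgw_sum_def left_diff_distrib sum_subtractf by (simp add: right_diff_distrib)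
qed

lemma pgw_sum_ge:
  assumes "sub_coupling S a T b w"
  shows "2 * lam * (1 - (sum w (S \<times> T))\<^sup>2) \<le> pgw_sum lam p \<delta> S \<epsilon> T w"
  unfolding pgw_sum_eq using assms
  by (force simp: sub_coupling_def intro!: sum_nonneg mult_nonneg_nonneg)

subsection \<open>The triangle inequality\<close>

text \<open>
  A partial coupling becomes a balanced one once a cemetery point \<^term>\<open>None\<close> absorbs the mass it
  leaves unmatched; the mass on \<^term>\<open>(None, None)\<close> gives both extended marginals total mass 2.
\<close>

definition adjoin :: "'a set \<Rightarrow> 'a option set" where
  "adjoin S = insert None (Some ` S)"

fun extend_coupling ::
  "'a set \<Rightarrow> ('a \<Rightarrow> real) \<Rightarrow> 'b set \<Rightarrow> ('b \<Rightarrow> real) \<Rightarrow> ('a \<times> 'b \<Rightarrow> real) \<Rightarrow> 'a option \<times> 'b option \<Rightarrow> real"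
where
  "extend_coupling S a T b w (Some x, Some y) = w (x, y)"
| "extend_coupling S a T b w (Some x, None) = a x - (\<Sum>y\<in>T. w (x, y))"
| "extend_coupling S a T b w (None, Some y) = b y - (\<Sum>x\<in>S. w (x, y))"
| "extend_coupling S a T b w (None, None) = sum w (S \<times> T)"

fun extend_dist :: "('a \<Rightarrow> 'a \<Rightarrow> real) \<Rightarrow> 'a option \<Rightarrow> 'a option \<Rightarrow> real option" where
  "extend_dist \<delta> (Some x) (Some x') = Some (\<delta> x x')"
| "extend_dist \<delta> _ _ = None"

text \<open>The value \<open>None\<close> marks a pair of points that involves the cemetery. The
  root is taken so that the \<open>p\<close>-th power of the gap is exactly the price
  \<open>lam\<close>.\<close>

fun gap :: "real \<Rightarrow> real \<Rightarrow> real option \<Rightarrow> real option \<Rightarrow> real" where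
  "gap lam p (Some s) (Some t) = \<bar>s - t\<bar>"
| "gap lam p None None = 0"
| "gap lam p _ _ = lam powr (1 / p)"

lemma finite_adjoin [simp]: "finite S \<Longrightarrow> finite (adjoin S)"
  by (simp add: adjoin_def)

lemma None_in_adjoin [simp]: "None \<in> adjoin S"
  and Some_in_adjoin [simp]: "Some x \<in> adjoin S \<longleftrightarrow> x \<in> S"
  by (auto simp: adjoin_def)

lemma sum_adjoin: "finite S \<Longrightarrow> sum f (adjoin S) = f None + (\<Sum>x\<in>S. f (Some x))"
  unfolding adjoin_def by (subst sum.insert) (auto simp: sum.reindex)

lemma gap_nonneg: "0 \<le> gap lam p s t"
  by (cases "(lam, p, s, t)" rule: gap.cases) auto

text \<open>The hypothesis excludes just one pattern, a detour between two genuine distances through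
  \<open>None\<close>, whose length is independent of \<open>\<bar>s - u\<bar>\<close>.\<close>

lemma gap_triangle:
  assumes "s = None \<or> t \<noteq> None \<or> u = None"
  shows "gap lam p s u \<le> gap lam p s t + gap lam p t u"
  using assms by (cases s; cases t; cases u) auto

lemma extend_coupling_nonneg:
  assumes "sub_coupling S a T b w" "z \<in> adjoin S \<times> adjoin T"
  shows "0 \<le> extend_coupling S a T b w z"
  using assms
  by (cases "(S, a, T, b, w, z)" rule: extend_coupling.cases)
    (auto simp: sub_coupling_def intro!: sum_nonneg)

text \<open>In the row of the cemetery, the unmatched mass of \<open>b\<close> and the corner entry
  \<open>sum w (S \<times> T)\<close> add up to 1.\<close>

lemma extend_coupling_row:
  assumes "finite S" "finite T" "sum b T = 1" "x \<in> adjoin S"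
  shows "(\<Sum>y\<in>adjoin T. extend_coupling S a T b w (x, y)) = (case x of None \<Rightarrow> 1 | Some x \<Rightarrow> a x)"
proof (cases x)
  case None
  have "(\<Sum>y\<in>T. \<Sum>x\<in>S. w (x, y)) = sum w (S \<times> T)"
    by (subst sum.swap) (simp add: sum.cartesian_product)
  with None assms show ?thesis by (simp add: sum_adjoin sum_subtractf)
qed (use assms in \<open>simp add: sum_adjoin\<close>)

lemma extend_coupling_column:
  assumes "finite S" "finite T" "sum a S = 1" "y \<in> adjoin T"
  shows "(\<Sum>x\<in>adjoin S. extend_coupling S a T b w (x, y)) = (case y of None \<Rightarrow> 1 | Some y \<Rightarrow> b y)"
proof (cases y)
  case None
  have "(\<Sum>x\<in>S. \<Sum>y\<in>T. w (x, y)) = sum w (S \<times> T)"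
    by (simp add: sum.cartesian_product)
  with None assms show ?thesis by (simp add: sum_adjoin sum_subtractf)
qed (use assms in \<open>simp add: sum_adjoin\<close>)

text \<open>The \<open>p\<close>-th power of the gap is the integrand of the objective on genuine
  pairs, plus \<open>lam\<close> for each side on which both points are genuine. Genuine points have
  total mass 1 on either side, so these two extra terms sum to \<open>2 * lam\<close>.\<close>

lemma pgw_sum_extend:
  assumes fin: "finite S" "finite T" and mass: "sum a S = 1" "sum b T = 1" and "1 \<le> p" "0 \<le> lam"
  shows "pgw_sum lam p \<delta> S \<epsilon> T w =
    (\<Sum>z\<in>adjoin S \<times> adjoin T. \<Sum>z'\<in>adjoin S \<times> adjoin T.
       extend_coupling S a T b w z * extend_coupling S a T b w z' *
       gap lam p (extend_dist \<delta> (fst z) (fst z')) (extend_dist \<epsilon> (snd z) (snd z')) powr p)"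
proof -
  define W where "W = extend_coupling S a T b w"
  define Z where "Z = adjoin S \<times> adjoin T"
  \<comment> \<open>\<open>core\<close> is the integrand of \<open>pgw_sum\<close> extended by zero;
    \<open>L\<close> and \<open>R\<close> below are the indicators of a genuine first and second
    coordinate.\<close>
  define core where "core z z' = (case (z, z') of
      ((Some x, Some y), (Some x', Some y')) \<Rightarrow> \<bar>\<delta> x x' - \<epsilon> y y'\<bar> powr p - 2 * lam | _ \<Rightarrow> 0)" for z z'
  define L :: "'a option \<times> 'b option \<Rightarrow> real" where "L z = (if fst z = None then 0 else 1)" for z
  define R :: "'a option \<times> 'b option \<Rightarrow> real" where "R z = (if snd z = None then 0 else 1)" for z
  have [simp]: "finite Z" using fin by (simp add: Z_def)
  have pw: "gap lam p (extend_dist \<delta> (fst z) (fst z')) (extend_dist \<epsilon> (snd z) (snd z')) powr p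
      = core z z' + lam * (L z * L z') + lam * (R z * R z')" for z z'
    using \<open>1 \<le> p\<close> \<open>0 \<le> lam\<close>
    by (cases z; cases z'; cases "fst z"; cases "fst z'"; cases "snd z"; cases "snd z'")
      (auto simp: core_def L_def R_def powr_powr)
  have L: "(\<Sum>z\<in>Z. W z * L z) = 1"
  proof -
    have "(\<Sum>z\<in>Z. W z * L z) = (\<Sum>x\<in>adjoin S. \<Sum>y\<in>adjoin T. W (x, y) * (if x = None then 0 else 1))"
      by (simp add: Z_def L_def sum.cartesian_product case_prod_unfold)
    also have "\<dots> = (\<Sum>x\<in>adjoin S. (case x of None \<Rightarrow> 1 | Some x \<Rightarrow> a x) * (if x = None then 0 else 1))"
      unfolding W_def sum_distrib_right[symmetric]
      by (intro sum.cong refl) (simp add: extend_coupling_row fin mass)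
    finally show ?thesis using mass fin by (simp add: sum_adjoin)
  qed
  have R: "(\<Sum>z\<in>Z. W z * R z) = 1"
  proof -
    have "(\<Sum>z\<in>Z. W z * R z) = (\<Sum>y\<in>adjoin T. \<Sum>x\<in>adjoin S. W (x, y) * (if y = None then 0 else 1))"
      by (subst sum.swap) (simp add: Z_def R_def sum.cartesian_product case_prod_unfold)
    also have "\<dots> = (\<Sum>y\<in>adjoin T. (case y of None \<Rightarrow> 1 | Some y \<Rightarrow> b y) * (if y = None then 0 else 1))"
      unfolding W_def sum_distrib_right[symmetric]
      by (intro sum.cong refl) (simp add: extend_coupling_column fin mass)
    finally show ?thesis using mass fin by (simp add: sum_adjoin)
  qed
  define e where "e z = (Some (fst z :: 'a), Some (snd z :: 'b))" for z
  have inj: "inj_on e (S \<times> T)" by (auto simp: e_def inj_on_def)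
  have sub: "e ` (S \<times> T) \<subseteq> Z" by (auto simp: e_def Z_def)
  \<comment> \<open>Points of \<open>Z\<close> outside the image of the embedding \<open>e\<close>
    have a cemetery coordinate, so both sums of \<open>core\<close> restrict to genuine
    points.\<close>
  have vanish: "core z z' = 0" if "z \<in> Z - e ` (S \<times> T) \<or> z' \<in> Z - e ` (S \<times> T)" for z z'
  proof -
    have "s \<in> e ` (S \<times> T)" if s: "s \<in> Z" "fst s \<noteq> None" "snd s \<noteq> None" for s
    proof -
      obtain x y where "s = (Some x, Some y)" using s by (cases s) auto
      then show ?thesis using s(1) by (intro image_eqI[of _ e "(x, y)"]) (auto simp: e_def Z_def)
    qed
    then have "fst z = None \<or> snd z = None \<or> fst z' = None \<or> snd z' = None" using that by blast
    then show ?thesis unfolding core_def by (cases z; cases z') (auto split: option.split)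
  qed
  have "(\<Sum>z\<in>Z. \<Sum>z'\<in>Z. W z * W z' * core z z') =
      (\<Sum>z\<in>e ` (S \<times> T). \<Sum>z'\<in>Z. W z * W z' * core z z')"
    using sub by (intro sum.mono_neutral_right) (auto simp: vanish)
  also have "\<dots> = (\<Sum>z\<in>e ` (S \<times> T). \<Sum>z'\<in>e ` (S \<times> T). W z * W z' * core z z')"
    using sub by (intro sum.cong refl sum.mono_neutral_right) (auto simp: vanish)
  also have "\<dots> = (\<Sum>z\<in>S \<times> T. \<Sum>z'\<in>S \<times> T. W (e z) * W (e z') * core (e z) (e z'))"
    by (simp add: sum.reindex[OF inj])
  also have "\<dots> = pgw_sum lam p \<delta> S \<epsilon> T w - 2 * lam"
    unfolding pgw_sum_def W_def by (simp add: e_def core_def mult_ac)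
  finally have core: "(\<Sum>z\<in>Z. \<Sum>z'\<in>Z. W z * W z' * core z z') = pgw_sum lam p \<delta> S \<epsilon> T w - 2 * lam" .
  have "(\<Sum>z\<in>Z. \<Sum>z'\<in>Z. W z * W z' *
       gap lam p (extend_dist \<delta> (fst z) (fst z')) (extend_dist \<epsilon> (snd z) (snd z')) powr p)
     = (\<Sum>z\<in>Z. \<Sum>z'\<in>Z. W z * W z' * core z z') + lam * ((\<Sum>z\<in>Z. W z * L z) * (\<Sum>z\<in>Z. W z * L z))
        + lam * ((\<Sum>z\<in>Z. W z * R z) * (\<Sum>z\<in>Z. W z * R z))"
    unfolding pw by (simp add: sum_product sum_distrib_left distrib_left sum.distrib mult_ac)
  then show ?thesis unfolding L R core by (simp add: W_def Z_def)
qed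

text \<open>Change of variables along \<open>\<pi>\<close>, used once in each argument: the double
  sum sees \<open>g\<close> only through its pushforward \<open>u\<close>. It moves the cost of a
  two-space coupling to the glued three-space measure.\<close>

lemma sum_pairs_pushforward:
  fixes g :: "'i \<Rightarrow> real"
  assumes "finite I" "finite J" and pi: "\<And>i. i \<in> I \<Longrightarrow> \<pi> i \<in> J"
    and u: "\<And>j. j \<in> J \<Longrightarrow> u j = (\<Sum>i | i \<in> I \<and> \<pi> i = j. g i)"
  shows "(\<Sum>i\<in>I. \<Sum>i'\<in>I. g i * g i' * F (\<pi> i) (\<pi> i')) = (\<Sum>j\<in>J. \<Sum>j'\<in>J. u j * u j' * F j j')"
proof -
  have push: "(\<Sum>i\<in>I. g i * H (\<pi> i)) = (\<Sum>j\<in>J. u j * H j)" for H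
  proof -
    have "(\<Sum>i\<in>I. g i * H (\<pi> i)) = (\<Sum>j\<in>J. \<Sum>i | i \<in> I \<and> \<pi> i = j. g i * H (\<pi> i))"
      using assms by (intro sum.group[symmetric]) auto
    also have "\<dots> = (\<Sum>j\<in>J. u j * H j)"
      by (intro sum.cong refl) (simp add: u sum_distrib_right)
    finally show ?thesis .
  qed
  have "(\<Sum>i\<in>I. \<Sum>i'\<in>I. g i * g i' * F (\<pi> i) (\<pi> i')) = (\<Sum>i\<in>I. g i * (\<Sum>i'\<in>I. g i' * F (\<pi> i) (\<pi> i')))"
    by (simp add: sum_distrib_left mult_ac)
  also have "\<dots> = (\<Sum>j\<in>J. u j * (\<Sum>j'\<in>J. u j' * F j j'))"
    by (subst push, subst push) (rule refl)
  finally show ?thesis by (simp add: sum_distrib_left mult_ac)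
qed

text \<open>
  The gluing puts no mass on triples \<open>(Some x, None, Some z)\<close>: for those \<^const>\<open>gap\<close> may
  violate the triangle inequality. This is possible exactly when \<^term>\<open>m\<close>, the mass left on
  \<open>(None, None, None)\<close>, is nonnegative.
\<close>

fun glue ::
  "('b \<Rightarrow> real) \<Rightarrow> real \<Rightarrow> ('a option \<times> 'b option \<Rightarrow> real) \<Rightarrow> ('b option \<times> 'c option \<Rightarrow> real)
     \<Rightarrow> 'a option \<times> 'b option \<times> 'c option \<Rightarrow> real" where
  "glue b m u v (x, Some y, z) = u (x, Some y) * v (Some y, z) / b y"
| "glue b m u v (Some x, None, None) = u (Some x, None)"
| "glue b m u v (None, None, Some z) = v (None, Some z)"
| "glue b m u v (Some x, None, Some z) = 0"
| "glue b m u v (None, None, None) = m"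

text \<open>The glued measure on triples has the extensions of \<open>u\<close>, \<open>v\<close>
  and \<open>w\<close> as its pair marginals. All three costs thus become sums over pairs of triples
  with common weights, and Minkowski's inequality compares them.\<close>

lemma pgw_sum_triangle_large_mass:
  fixes S :: "'a set" and T :: "'b set" and U :: "'c set"
  assumes fin: "finite S" "finite T" "finite U"
    and mass: "sum a S = 1" "sum b T = 1" "sum c U = 1"
    and bpos: "\<And>y. y \<in> T \<Longrightarrow> 0 < b y"
    and p: "1 \<le> p" and lam: "0 \<le> lam"
    and u: "sub_coupling S a T b u" and v: "sub_coupling T b U c v"
    and large: "1 \<le> sum u (S \<times> T) + sum v (T \<times> U)"
  obtains w where "sub_coupling S a U c w"
    and "pgw_sum lam p \<delta> S \<zeta> U w powr (1 / p)
      \<le> pgw_sum lam p \<delta> S \<epsilon> T u powr (1 / p) + pgw_sum lam p \<epsilon> T \<zeta> U v powr (1 / p)"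
proof -
  define w where "w = (\<lambda>(x, z). \<Sum>y\<in>T. u (x, y) * v (y, z) / b y)"
  define u' where "u' = extend_coupling S a T b u"
  define v' where "v' = extend_coupling T b U c v"
  define w' where "w' = extend_coupling S a U c w"
  \<comment> \<open>This value is forced by the marginals: the triples
    \<open>(None, None, z)\<close> must carry \<open>sum u (S \<times> T)\<close>, of which the
    genuine \<open>z\<close> already receive \<open>1 - sum v (T \<times> U)\<close>.\<close>
  define m where "m = sum u (S \<times> T) + sum v (T \<times> U) - 1"
  define g where "g = glue b m u' v'"
  define I where "I = adjoin S \<times> adjoin T \<times> adjoin U"
  have [simp]: "finite I" using fin by (simp add: I_def)
  note uD = sub_couplingD[OF u] and vD = sub_couplingD[OF v]
  have row: "(\<Sum>z\<in>U. w (x, z)) = (\<Sum>y\<in>T. u (x, y) * (\<Sum>z\<in>U. v (y, z)) / b y)" for x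
    unfolding w_def by (simp, subst sum.swap) (simp add: sum_distrib_left sum_divide_distrib)
  have col: "(\<Sum>x\<in>S. w (x, z)) = (\<Sum>y\<in>T. (\<Sum>x\<in>S. u (x, y)) * v (y, z) / b y)" for z
    unfolding w_def by (simp, subst sum.swap) (simp add: sum_distrib_right sum_divide_distrib)
  have total: "sum w (S \<times> U) = (\<Sum>y\<in>T. (\<Sum>x\<in>S. u (x, y)) * (\<Sum>z\<in>U. v (y, z)) / b y)"
  proof -
    have "sum w (S \<times> U) = (\<Sum>x\<in>S. \<Sum>z\<in>U. w (x, z))" by (simp add: sum.cartesian_product)
    then show ?thesis
      unfolding row by (simp, subst sum.swap) (simp add: sum_distrib_right sum_divide_distrib)
  qed
  have w: "sub_coupling S a U c w"
    unfolding sub_coupling_def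
  proof (intro conjI ballI)
    fix s assume "s \<in> S \<times> U"
    then show "0 \<le> w s"
      using uD(1) vD(1) bpos unfolding w_def by (auto intro!: sum_nonneg divide_nonneg_pos)
  next
    fix x assume x: "x \<in> S"
    have "(\<Sum>z\<in>U. w (x, z)) \<le> (\<Sum>y\<in>T. u (x, y))"
      unfolding row
    proof (rule sum_mono)
      fix y assume y: "y \<in> T"
      show "u (x, y) * (\<Sum>z\<in>U. v (y, z)) / b y \<le> u (x, y)"
        using mult_left_mono[OF vD(2)[OF y] uD(1)[OF x y]] bpos[OF y] by (simp add: divide_simps)
    qed
    with uD(2)[OF x] show "(\<Sum>z\<in>U. w (x, z)) \<le> a x" by linarith
  next
    fix z assume z: "z \<in> U"
    have "(\<Sum>x\<in>S. w (x, z)) \<le> (\<Sum>y\<in>T. v (y, z))"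
      unfolding col
    proof (rule sum_mono)
      fix y assume y: "y \<in> T"
      show "(\<Sum>x\<in>S. u (x, y)) * v (y, z) / b y \<le> v (y, z)"
        using mult_right_mono[OF uD(3)[OF y] vD(1)[OF y z]] bpos[OF y]
        by (simp add: divide_simps mult_ac)
    qed
    with vD(3)[OF z] show "(\<Sum>x\<in>S. w (x, z)) \<le> c z" by linarith
  qed
  have u'0: "0 \<le> u' s" if s0: "s \<in> adjoin S \<times> adjoin T" for s
    unfolding u'_def by (rule extend_coupling_nonneg[OF u that])
  have v'0: "0 \<le> v' s" if s0: "s \<in> adjoin T \<times> adjoin U" for s
    unfolding v'_def by (rule extend_coupling_nonneg[OF v that])
  have g0: "0 \<le> g i" if "i \<in> I" for i
    using that u'0 v'0 bpos large unfolding g_def m_def I_def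
    by (cases "(b, m, u', v', i)" rule: glue.cases) (auto intro!: divide_nonneg_pos mult_nonneg_nonneg)
  note marg = extend_coupling_row[OF fin(2,3) mass(3)] extend_coupling_column[OF fin(1,2) mass(1)]
  have margU: "(\<Sum>z\<in>adjoin U. g (x, y, z)) = u' (x, y)" if "x \<in> adjoin S" "y \<in> adjoin T" for x y
  proof (cases y)
    case (Some t)
    then have "t \<in> T" using that by simp
    have "(\<Sum>z\<in>adjoin U. g (x, y, z)) = u' (x, y) * (\<Sum>z\<in>adjoin U. v' (y, z)) / b t"
      by (simp add: Some g_def sum_distrib_left sum_divide_distrib)
    with marg(1)[OF that(2), of b v] Some bpos[OF \<open>t \<in> T\<close>] show ?thesis by (simp add: v'_def)
  next
    case None
    have "(\<Sum>z\<in>adjoin U. v' (None, z)) = 1"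
      using marg(1)[of None b v] by (simp add: v'_def)
    then have "(\<Sum>z\<in>U. v' (None, Some z)) = 1 - sum v (T \<times> U)"
      using fin by (simp add: sum_adjoin v'_def)
    then show ?thesis
      using None fin by (cases x) (simp_all add: sum_adjoin g_def m_def u'_def)
  qed
  have margS: "(\<Sum>x\<in>adjoin S. g (x, y, z)) = v' (y, z)" if "y \<in> adjoin T" "z \<in> adjoin U" for y z
  proof (cases y)
    case (Some t)
    then have "t \<in> T" using that by simp
    have "(\<Sum>x\<in>adjoin S. g (x, y, z)) = (\<Sum>x\<in>adjoin S. u' (x, y)) * v' (y, z) / b t"
      by (simp add: Some g_def sum_distrib_right sum_divide_distrib)
    with marg(2)[OF that(1), of b u] Some bpos[OF \<open>t \<in> T\<close>] show ?thesis by (simp add: u'_def)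
  next
    case None
    have "(\<Sum>x\<in>adjoin S. u' (x, None)) = 1"
      using marg(2)[of None b u] by (simp add: u'_def)
    then have "(\<Sum>x\<in>S. u' (Some x, None)) = 1 - sum u (S \<times> T)"
      using fin by (simp add: sum_adjoin u'_def)
    then show ?thesis
      using None fin by (cases z) (simp_all add: sum_adjoin g_def m_def v'_def)
  qed
  \<comment> \<open>The outer marginal is precisely the extension of \<open>w\<close>, so
    \<open>pgw_sum_extend\<close> applies to \<open>w\<close> too.\<close>
  have margT: "(\<Sum>y\<in>adjoin T. g (x, y, z)) = w' (x, z)" if "x \<in> adjoin S" "z \<in> adjoin U" for x z
  proof -
    have *: "b y * q / b y = q" "q * b y / b y = q" if "y \<in> T" for y q
      using bpos[OF that] by auto
    show ?thesis
    proof (cases x; cases z)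
      fix s r assume "x = Some s" "z = Some r"
      then show ?thesis using fin by (simp add: sum_adjoin g_def u'_def v'_def w'_def w_def)
    next
      fix s assume "x = Some s" "z = None"
      then show ?thesis using fin
        by (simp add: sum_adjoin g_def u'_def v'_def w'_def row right_diff_distrib
            diff_divide_distrib sum_subtractf * cong: sum.cong)
    next
      fix r assume "x = None" "z = Some r"
      then show ?thesis using fin
        by (simp add: sum_adjoin g_def u'_def v'_def w'_def col left_diff_distrib
            diff_divide_distrib sum_subtractf * cong: sum.cong)
    next
      assume [simp]: "x = None" "z = None"
      define A B where "A y = (\<Sum>x\<in>S. u (x, y))" and "B y = (\<Sum>z\<in>U. v (y, z))" for y
      have sums: "sum A T = sum u (S \<times> T)" "sum B T = sum v (T \<times> U)"
        unfolding A_def B_def by (subst sum.swap) (simp_all add: sum.cartesian_product)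
      \<comment> \<open>Summed over \<open>y\<close>, the first three terms give \<open>- m\<close>,
        which cancels the mass of the triple of cemeteries; the quotient gives the mass of
        \<open>w\<close>.\<close>
      have "(b y - A y) * (b y - B y) / b y = b y - A y - B y + A y * B y / b y" if "y \<in> T" for y
        using bpos[OF that] by (simp add: field_simps)
      then have "(\<Sum>y\<in>T. (b y - A y) * (b y - B y) / b y)
          = sum b T - sum A T - sum B T + (\<Sum>y\<in>T. A y * B y / b y)"
        by (simp add: sum.distrib sum_subtractf)
      then show ?thesis using fin
        by (simp add: sum_adjoin g_def u'_def v'_def w'_def total m_def mass sums
            flip: A_def B_def)
    qed
  qed
  \<comment> \<open>The marginal identities are restated as sums over fibres of projections, the
    form in which \<open>sum_pairs_pushforward\<close> takes them.\<close>
  have fibU: "u' s = (\<Sum>i | i \<in> I \<and> (fst i, fst (snd i)) = s. g i)" if s0: "s \<in> adjoin S \<times> adjoin T" for s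
  proof -
    obtain x y where s: "s = (x, y)" "x \<in> adjoin S" "y \<in> adjoin T" using s0 by auto
    then have "{i. i \<in> I \<and> (fst i, fst (snd i)) = s} = (\<lambda>z. (x, y, z)) ` adjoin U" by (auto simp: I_def)
    then show ?thesis using margU s by (simp add: sum.reindex inj_on_def)
  qed
  have fibS: "v' s = (\<Sum>i | i \<in> I \<and> snd i = s. g i)" if s0: "s \<in> adjoin T \<times> adjoin U" for s
  proof -
    obtain y z where s: "s = (y, z)" "y \<in> adjoin T" "z \<in> adjoin U" using s0 by auto
    then have "{i. i \<in> I \<and> snd i = s} = (\<lambda>x. (x, y, z)) ` adjoin S" by (auto simp: I_def)
    then show ?thesis using margS s by (simp add: sum.reindex inj_on_def)
  qed
  have fibT: "w' s = (\<Sum>i | i \<in> I \<and> (fst i, snd (snd i)) = s. g i)" if s0: "s \<in> adjoin S \<times> adjoin U" for s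
  proof -
    obtain x z where s: "s = (x, z)" "x \<in> adjoin S" "z \<in> adjoin U" using s0 by auto
    then have "{i. i \<in> I \<and> (fst i, snd (snd i)) = s} = (\<lambda>y. (x, y, z)) ` adjoin T" by (auto simp: I_def)
    then show ?thesis using margT s by (simp add: sum.reindex inj_on_def)
  qed
  define DS where "DS i i' = extend_dist \<delta> (fst i) (fst i')" for i i' :: "'a option \<times> 'b option \<times> 'c option"
  define DT where "DT i i' = extend_dist \<epsilon> (fst (snd i)) (fst (snd i'))" for i i' :: "'a option \<times> 'b option \<times> 'c option"
  define DU where "DU i i' = extend_dist \<zeta> (snd (snd i)) (snd (snd i'))" for i i' :: "'a option \<times> 'b option \<times> 'c option"
  have Eu: "pgw_sum lam p \<delta> S \<epsilon> T u = (\<Sum>(i, i')\<in>I \<times> I. g i * g i' * gap lam p (DS i i') (DT i i') powr p)"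
    unfolding pgw_sum_extend[OF fin(1,2) mass(1,2) p lam] sum.cartesian_product[symmetric]
    by (subst sum_pairs_pushforward[where I = I and g = g and \<pi> = "\<lambda>i. (fst i, fst (snd i))", symmetric])
      (use fin fibU in \<open>auto simp: u'_def DS_def DT_def I_def\<close>)
  have Ev: "pgw_sum lam p \<epsilon> T \<zeta> U v = (\<Sum>(i, i')\<in>I \<times> I. g i * g i' * gap lam p (DT i i') (DU i i') powr p)"
    unfolding pgw_sum_extend[OF fin(2,3) mass(2,3) p lam] sum.cartesian_product[symmetric]
    by (subst sum_pairs_pushforward[where I = I and g = g and \<pi> = snd, symmetric])
      (use fin fibS in \<open>auto simp: v'_def DT_def DU_def I_def\<close>)
  have Ew: "pgw_sum lam p \<delta> S \<zeta> U w = (\<Sum>(i, i')\<in>I \<times> I. g i * g i' * gap lam p (DS i i') (DU i i') powr p)"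
    unfolding pgw_sum_extend[OF fin(1,3) mass(1,3) p lam] sum.cartesian_product[symmetric]
    by (subst sum_pairs_pushforward[where I = I and g = g and \<pi> = "\<lambda>i. (fst i, snd (snd i))", symmetric])
      (use fin fibT in \<open>auto simp: w'_def DS_def DU_def I_def\<close>)
  \<comment> \<open>A forbidden detour would need genuine outer points in both triples and a
    cemetery in the middle of one of them, but \<open>glue\<close> gives such a triple weight
    0.\<close>
  have tri: "gap lam p (DS i i') (DU i i') \<le> gap lam p (DS i i') (DT i i') + gap lam p (DT i i') (DU i i')"
    if "g i * g i' \<noteq> 0" for i i'
  proof (rule gap_triangle)
    have good: "fst i = None \<or> fst (snd i) \<noteq> None \<or> snd (snd i) = None" if "g i \<noteq> 0" for i
      using that unfolding g_def by (cases "(b, m, u', v', i)" rule: glue.cases) auto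
    show "DS i i' = None \<or> DT i i' \<noteq> None \<or> DU i i' = None"
      using good[of i] good[of i'] that unfolding DS_def DT_def DU_def
      by (cases "fst i"; cases "fst i'"; cases "fst (snd i)"; cases "fst (snd i')";
          cases "snd (snd i)"; cases "snd (snd i')") auto
  qed
  have "pgw_sum lam p \<delta> S \<zeta> U w powr (1 / p)
      \<le> pgw_sum lam p \<delta> S \<epsilon> T u powr (1 / p) + pgw_sum lam p \<epsilon> T \<zeta> U v powr (1 / p)"
    unfolding Eu Ev Ew case_prod_unfold
    by (rule minkowski_sum[OF p]) (auto simp: gap_nonneg g0 tri)
  with w show thesis by (rule that)
qed

lemma pgw_sum_triangle:
  fixes S :: "'a set" and T :: "'b set" and U :: "'c set"
  assumes fin: "finite S" "finite T" "finite U"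
    and mass: "sum a S = 1" "sum b T = 1" "sum c U = 1"
    and pos: "\<And>x. x \<in> S \<Longrightarrow> 0 \<le> a x" "\<And>y. y \<in> T \<Longrightarrow> 0 < b y" "\<And>z. z \<in> U \<Longrightarrow> 0 \<le> c z"
    and p: "1 \<le> p" and lam: "0 \<le> lam"
    and u: "sub_coupling S a T b u" and v: "sub_coupling T b U c v"
  obtains w where "sub_coupling S a U c w"
    and "pgw_sum lam p \<delta> S \<zeta> U w powr (1 / p)
      \<le> pgw_sum lam p \<delta> S \<epsilon> T u powr (1 / p) + pgw_sum lam p \<epsilon> T \<zeta> U v powr (1 / p)"
proof (cases "1 \<le> sum u (S \<times> T) + sum v (T \<times> U)")
  case True
  show ?thesis
    by (rule pgw_sum_triangle_large_mass[OF fin mass pos(2) p lam u v True, of \<delta> \<zeta> \<epsilon>]) (auto intro: that)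
next
  case False
  define m n where "m = sum u (S \<times> T)" and "n = sum v (T \<times> U)"
  have mn: "0 \<le> m" "0 \<le> n" "m + n \<le> 1"
    using sub_coupling_mass[OF u] sub_coupling_mass[OF v] mass False by (auto simp: m_def n_def)
  \<comment> \<open>From here on only the mass penalties of the two couplings are used.\<close>
  have "m\<^sup>2 + n\<^sup>2 \<le> (m + n)\<^sup>2" using mn by (simp add: power2_sum)
  also have "\<dots> \<le> 1" using mn by (simp add: power_le_one)
  finally have sq: "m\<^sup>2 + n\<^sup>2 \<le> 1" .
  have sq1: "m\<^sup>2 \<le> 1" "n\<^sup>2 \<le> 1" using mn by (auto simp: power_le_one)
  let ?E = "pgw_sum lam p \<delta> S \<epsilon> T u" and ?F = "pgw_sum lam p \<epsilon> T \<zeta> U v"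
  have EF: "2 * lam * (1 - m\<^sup>2) \<le> ?E" "2 * lam * (1 - n\<^sup>2) \<le> ?F"
    unfolding m_def n_def by (intro pgw_sum_ge[OF u] pgw_sum_ge[OF v])+
  have EF0: "0 \<le> ?E" "0 \<le> ?F"
    using EF mult_nonneg_nonneg[of "2 * lam" "1 - m\<^sup>2"] mult_nonneg_nonneg[of "2 * lam" "1 - n\<^sup>2"] lam sq1
    by linarith+
  have "2 * lam * 1 \<le> 2 * lam * (2 - m\<^sup>2 - n\<^sup>2)" using lam sq by (intro mult_left_mono) auto
  with EF have "2 * lam \<le> ?E + ?F" by (simp add: algebra_simps)
  then have "(2 * lam) powr (1 / p) \<le> (?E + ?F) powr (1 / p)"
    using p lam by (intro powr_mono2) auto
  also have "\<dots> \<le> ?E powr (1 / p) + ?F powr (1 / p)"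
    using EF0 p by (rule powr_inverse_subadditive)
  finally show ?thesis
    \<comment> \<open>The witness is the empty coupling, whose cost is
      \<open>2 * lam\<close>.\<close>
    by (intro that[of "\<lambda>_. 0"]) (auto simp: sub_coupling_def pgw_sum_def pos)
qed

subsection \<open>Minimizers, balanced couplings and zero cost\<close>

lemma sum_rows: "(\<Sum>x\<in>S. \<Sum>y\<in>T. w (x, y)) = sum w (S \<times> T)"
  by (simp add: sum.cartesian_product)

lemma sum_columns: "(\<Sum>y\<in>T. \<Sum>x\<in>S. w (x, y)) = sum w (S \<times> T)"
  by (subst sum.swap) (rule sum_rows)

lemma pgw_sum_cong:
  assumes "\<And>z. z \<in> S \<times> T \<Longrightarrow> w z = w' z"
  shows "pgw_sum lam p \<delta> S \<epsilon> T w = pgw_sum lam p \<delta> S \<epsilon> T w'"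
  unfolding pgw_sum_def using assms by (intro arg_cong2[where f = "(+)"] sum.cong refl) auto

lemma sub_coupling_cong:
  assumes "\<And>z. z \<in> S \<times> T \<Longrightarrow> w z = w' z"
  shows "sub_coupling S a T b w \<longleftrightarrow> sub_coupling S a T b w'"
  unfolding sub_coupling_def using assms by (auto cong: sum.cong)

text \<open>The cube of all functions into the unit interval is compact in the product topology.
  Partial couplings in it form a closed subset, and the objective is continuous, as it involves
  finitely many coordinates.\<close>

lemma pgw_sum_minimizer:
  fixes S :: "'a set" and T :: "'b set"
  assumes fin: "finite S" "finite T" and mass: "sum a S = 1"
    and nonneg: "\<And>x. x \<in> S \<Longrightarrow> 0 \<le> a x" "\<And>y. y \<in> T \<Longrightarrow> 0 \<le> b y"
  obtains w where "sub_coupling S a T b w"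
    and "\<And>w'. sub_coupling S a T b w' \<Longrightarrow> pgw_sum lam p \<delta> S \<epsilon> T w \<le> pgw_sum lam p \<delta> S \<epsilon> T w'"
proof -
  define C :: "('a \<times> 'b \<Rightarrow> real) set" where "C = PiE UNIV (\<lambda>_. {0..1})"
  define K where "K = C \<inter> {w. sub_coupling S a T b w}"
  have "compactin (product_topology (\<lambda>_. euclidean) UNIV) C"
    unfolding C_def by (simp add: compactin_PiE)
  then have "compact C"
    by (simp add: euclidean_product_topology)
  have cont: "continuous_on A (\<lambda>w::'a \<times> 'b \<Rightarrow> real. w z)" for A z
    by (rule continuous_on_subset[OF continuous_on_product_coordinates]) simp
  have "{w. sub_coupling S a T b w} = (\<Inter>z\<in>S \<times> T. {w. 0 \<le> w z})
      \<inter> (\<Inter>x\<in>S. {w. (\<Sum>y\<in>T. w (x, y)) \<le> a x}) \<inter> (\<Inter>y\<in>T. {w. (\<Sum>x\<in>S. w (x, y)) \<le> b y})"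
    by (auto simp: sub_coupling_def)
  also have "closed \<dots>"
    by (intro closed_Int closed_INT ballI closed_Collect_le continuous_intros cont)
  finally have "compact K"
    unfolding K_def using \<open>compact C\<close> by (rule compact_Int_closed[rotated])
  moreover have "(\<lambda>_. 0) \<in> K"
    using nonneg by (auto simp: K_def C_def sub_coupling_def)
  moreover have "continuous_on K (pgw_sum lam p \<delta> S \<epsilon> T)"
    unfolding pgw_sum_def by (intro continuous_intros cont)
  ultimately obtain w where w: "w \<in> K" "\<And>w'. w' \<in> K \<Longrightarrow> pgw_sum lam p \<delta> S \<epsilon> T w \<le> pgw_sum lam p \<delta> S \<epsilon> T w'"
    using continuous_attains_inf[of K "pgw_sum lam p \<delta> S \<epsilon> T"] by blast
  show thesis
  proof (rule that)
    show "sub_coupling S a T b w" using w(1) by (simp add: K_def)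
    fix w' assume w': "sub_coupling S a T b w'"
    \<comment> \<open>A competitor is unconstrained off \<open>S \<times> T\<close>; resetting it
      there puts it into the cube without changing its cost.\<close>
    define w'' where "w'' z = (if z \<in> S \<times> T then w' z else 0)" for z
    have "w' z \<le> 1" if "z \<in> S \<times> T" for z
    proof -
      have "w' z \<le> sum w' (S \<times> T)"
        using fin w' that by (intro member_le_sum) (auto simp: sub_coupling_def)
      then show ?thesis using sub_coupling_mass(2)[OF w' mass] by linarith
    qed
    then have "w'' \<in> C" using w' by (auto simp: C_def w''_def sub_coupling_def)
    moreover have "sub_coupling S a T b w''"
      using w' by (subst sub_coupling_cong[of _ _ _ w']) (auto simp: w''_def)
    ultimately have "w'' \<in> K" by (simp add: K_def)
    then have "pgw_sum lam p \<delta> S \<epsilon> T w \<le> pgw_sum lam p \<delta> S \<epsilon> T w''" by (rule w)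
    also have "\<dots> = pgw_sum lam p \<delta> S \<epsilon> T w'" by (rule pgw_sum_cong) (simp add: w''_def)
    finally show "pgw_sum lam p \<delta> S \<epsilon> T w \<le> pgw_sum lam p \<delta> S \<epsilon> T w'" .
  qed
qed

lemma sub_coupling_swap: "sub_coupling S a T b w \<Longrightarrow> sub_coupling T b S a (w \<circ> prod.swap)"
  by (auto simp: sub_coupling_def)

lemma pgw_sum_swap:
  fixes S :: "'a set" and T :: "'b set"
  shows "pgw_sum lam p \<epsilon> T \<delta> S (w \<circ> prod.swap) = pgw_sum lam p \<delta> S \<epsilon> T w"
proof -
  have "(\<Sum>z\<in>T \<times> S. \<Sum>z'\<in>T \<times> S. f (prod.swap z) (prod.swap z'))
      = (\<Sum>z\<in>S \<times> T. \<Sum>z'\<in>S \<times> T. f z z')" for f :: "'a \<times> 'b \<Rightarrow> 'a \<times> 'b \<Rightarrow> real"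
    unfolding product_swap[of S T, symmetric] by (simp add: sum.reindex)
  from this[of "\<lambda>z z'. (\<bar>\<delta> (fst z) (fst z') - \<epsilon> (snd z) (snd z')\<bar> powr p - 2 * lam) * (w z * w z')"]
  show ?thesis unfolding pgw_sum_def by (simp add: abs_minus_commute)
qed

section \<open>Balanced couplings, completion and zero cost\<close>

definition full_coupling :: "'a set \<Rightarrow> ('a \<Rightarrow> real) \<Rightarrow> 'b set \<Rightarrow> ('b \<Rightarrow> real) \<Rightarrow> ('a \<times> 'b \<Rightarrow> real) \<Rightarrow> bool"
where
  "full_coupling S a T b w \<longleftrightarrow> (\<forall>z\<in>S \<times> T. 0 \<le> w z)
     \<and> (\<forall>x\<in>S. (\<Sum>y\<in>T. w (x, y)) = a x) \<and> (\<forall>y\<in>T. (\<Sum>x\<in>S. w (x, y)) = b y)"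

lemma full_coupling_imp_sub_coupling: "full_coupling S a T b w \<Longrightarrow> sub_coupling S a T b w"
  by (simp add: full_coupling_def sub_coupling_def)

lemma full_coupling_mass: "full_coupling S a T b w \<Longrightarrow> sum w (S \<times> T) = sum a S"
  unfolding full_coupling_def sum_rows[symmetric] by (simp cong: sum.cong)

text \<open>The marginal deficits are nonnegative and sum to one minus the mass, so full mass forces
  each of them to vanish.\<close>

lemma sub_coupling_full_iff:
  assumes fin: "finite S" "finite T" and mass: "sum a S = 1" "sum b T = 1"
    and w: "sub_coupling S a T b w"
  shows "full_coupling S a T b w \<longleftrightarrow> sum w (S \<times> T) = 1"
proof
  assume "full_coupling S a T b w"
  with mass show "sum w (S \<times> T) = 1" by (simp add: full_coupling_mass)
next
  assume m: "sum w (S \<times> T) = 1"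
  have "(\<Sum>x\<in>S. a x - (\<Sum>y\<in>T. w (x, y))) = 0"
    using m mass by (simp add: sum_subtractf sum_rows)
  then have "\<forall>x\<in>S. a x - (\<Sum>y\<in>T. w (x, y)) = 0"
    using fin sub_couplingD(2)[OF w] by (subst (asm) sum_nonneg_eq_0_iff) auto
  moreover have "(\<Sum>y\<in>T. b y - (\<Sum>x\<in>S. w (x, y))) = 0"
    using m mass by (simp add: sum_subtractf sum_columns)
  then have "\<forall>y\<in>T. b y - (\<Sum>x\<in>S. w (x, y)) = 0"
    using fin sub_couplingD(3)[OF w] by (subst (asm) sum_nonneg_eq_0_iff) auto
  ultimately show "full_coupling S a T b w"
    using w by (auto simp: full_coupling_def sub_coupling_def)
qed

text \<open>Both marginals miss the same amount of mass, so the product of the deficits, divided by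
  that amount, supplies exactly what is missing.\<close>

lemma sub_coupling_extends_to_full:
  fixes S :: "'a set" and T :: "'b set"
  assumes fin: "finite S" "finite T" and mass: "sum a S = 1" "sum b T = 1"
    and w: "sub_coupling S a T b w"
  obtains w' where "full_coupling S a T b w'" and "\<And>z. z \<in> S \<times> T \<Longrightarrow> w z \<le> w' z"
proof (cases "sum w (S \<times> T) = 1")
  case True
  with sub_coupling_full_iff[OF fin mass w] that show ?thesis by blast
next
  case False
  define m where "m = sum w (S \<times> T)"
  define r where "r x = a x - (\<Sum>y\<in>T. w (x, y))" for x
  define s where "s y = b y - (\<Sum>x\<in>S. w (x, y))" for y
  have m: "m < 1" using False sub_coupling_mass[OF w mass(1)] by (simp add: m_def)
  have r: "sum r S = 1 - m" "\<And>x. x \<in> S \<Longrightarrow> 0 \<le> r x"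
    using sub_couplingD(2)[OF w] by (simp_all add: r_def m_def sum_subtractf mass sum_rows)
  have s: "sum s T = 1 - m" "\<And>y. y \<in> T \<Longrightarrow> 0 \<le> s y"
    using sub_couplingD(3)[OF w]
    by (simp_all add: s_def m_def sum_subtractf mass sum_columns)
  define w' where "w' = (\<lambda>(x, y). w (x, y) + r x * s y / (1 - m))"
  have le: "w z \<le> w' z" if "z \<in> S \<times> T" for z
    using that r s m by (auto simp: w'_def)
  have "(\<Sum>y\<in>T. w' (x, y)) = a x" for x
  proof -
    have "(\<Sum>y\<in>T. w' (x, y)) = (\<Sum>y\<in>T. w (x, y)) + r x * sum s T / (1 - m)"
      by (simp add: w'_def sum.distrib sum_distrib_left sum_divide_distrib)
    then show ?thesis using m s by (simp add: r_def)
  qed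
  moreover have "(\<Sum>x\<in>S. w' (x, y)) = b y" for y
  proof -
    have "(\<Sum>x\<in>S. w' (x, y)) = (\<Sum>x\<in>S. w (x, y)) + sum r S * s y / (1 - m)"
      by (simp add: w'_def sum.distrib sum_distrib_right sum_divide_distrib)
    then show ?thesis using m r by (simp add: s_def)
  qed
  moreover have "0 \<le> w' z" if "z \<in> S \<times> T" for z
    using le[OF that] w that by (force simp: sub_coupling_def)
  ultimately show ?thesis
    using le by (intro that[of w']) (auto simp: full_coupling_def)
qed

text \<open>Every coefficient of the quadratic form is nonpositive, while the products of weights
  grow with the weights.\<close>

lemma pgw_sum_antimono:
  assumes "\<And>z. z \<in> S \<times> T \<Longrightarrow> 0 \<le> w z" "\<And>z. z \<in> S \<times> T \<Longrightarrow> w z \<le> w' z"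
    and "\<And>x x' y y'. x \<in> S \<Longrightarrow> x' \<in> S \<Longrightarrow> y \<in> T \<Longrightarrow> y' \<in> T \<Longrightarrow> \<bar>\<delta> x x' - \<epsilon> y y'\<bar> powr p \<le> 2 * lam"
  shows "pgw_sum lam p \<delta> S \<epsilon> T w' \<le> pgw_sum lam p \<delta> S \<epsilon> T w"
proof -
  have "(\<bar>\<delta> (fst z) (fst z') - \<epsilon> (snd z) (snd z')\<bar> powr p - 2 * lam) * (w' z * w' z')
      \<le> (\<bar>\<delta> (fst z) (fst z') - \<epsilon> (snd z) (snd z')\<bar> powr p - 2 * lam) * (w z * w z')"
    if "z \<in> S \<times> T" "z' \<in> S \<times> T" for z z'
    using that assms(1)[of z] assms(1)[of z'] assms(2)[of z] assms(2)[of z']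
      assms(3)[of "fst z" "fst z'" "snd z" "snd z'"]
    by (intro mult_left_mono_neg mult_mono) (auto simp: mem_Times_iff)
  then show ?thesis unfolding pgw_sum_def by (intro add_mono sum_mono) auto
qed

text \<open>Distortion and mass penalty are both nonnegative, so both vanish. The penalty vanishes
  only at mass 1, hence for balanced couplings; the distortion vanishes only termwise.\<close>

lemma pgw_sum_eq_0_iff:
  assumes w: "sub_coupling S a T b w" and fin: "finite S" "finite T"
    and mass: "sum a S = 1" "sum b T = 1" and lam: "0 < lam"
  shows "pgw_sum lam p \<delta> S \<epsilon> T w = 0 \<longleftrightarrow> full_coupling S a T b w \<and>
    (\<forall>x\<in>S. \<forall>y\<in>T. \<forall>x'\<in>S. \<forall>y'\<in>T. w (x, y) \<noteq> 0 \<longrightarrow> w (x', y') \<noteq> 0 \<longrightarrow> \<delta> x x' = \<epsilon> y y')"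
proof -
  define c where "c z z' = \<bar>\<delta> (fst z) (fst z') - \<epsilon> (snd z) (snd z')\<bar> powr p * (w z * w z')" for z z'
  define m where "m = sum w (S \<times> T)"
  have c0: "0 \<le> c z z'" if "z \<in> S \<times> T" "z' \<in> S \<times> T" for z z'
    using w that unfolding c_def sub_coupling_def by (intro mult_nonneg_nonneg) auto
  have m: "0 \<le> m" "m \<le> 1" using sub_coupling_mass[OF w mass(1)] by (auto simp: m_def)
  then have sq: "m\<^sup>2 \<le> 1" "m\<^sup>2 = 1 \<longleftrightarrow> m = 1" by (auto simp: power_le_one power2_eq_1_iff)
  have "pgw_sum lam p \<delta> S \<epsilon> T w = (\<Sum>z\<in>S \<times> T. \<Sum>z'\<in>S \<times> T. c z z') + 2 * lam * (1 - m\<^sup>2)"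
    by (simp add: pgw_sum_eq c_def m_def)
  also have "\<dots> = 0 \<longleftrightarrow> (\<Sum>z\<in>S \<times> T. \<Sum>z'\<in>S \<times> T. c z z') = 0 \<and> 2 * lam * (1 - m\<^sup>2) = 0"
    using lam sq c0 by (intro add_nonneg_eq_0_iff sum_nonneg mult_nonneg_nonneg) auto
  also have "(\<Sum>z\<in>S \<times> T. \<Sum>z'\<in>S \<times> T. c z z') = 0 \<longleftrightarrow> (\<forall>z\<in>S \<times> T. \<forall>z'\<in>S \<times> T. c z z' = 0)"
    using fin c0 by (simp add: sum_nonneg_eq_0_iff sum_nonneg)
  also have "2 * lam * (1 - m\<^sup>2) = 0 \<longleftrightarrow> full_coupling S a T b w"
    using lam sq sub_coupling_full_iff[OF fin mass w] by (auto simp: m_def)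
  finally show ?thesis by (fastforce simp: c_def)
qed

text \<open>Positive weights make the support meet every row and column. Since distances agree on
  the support and vanish only on the diagonal, it meets each of them once; that single entry equals
  both marginal weights.\<close>

lemma pgw_sum_eq_0_imp_isomorphic:
  assumes w: "sub_coupling S a T b w" and fin: "finite S" "finite T"
    and mass: "sum a S = 1" "sum b T = 1" and lam: "0 < lam"
    and pos: "\<And>x. x \<in> S \<Longrightarrow> 0 < a x" "\<And>y. y \<in> T \<Longrightarrow> 0 < b y"
    and sep: "\<And>x x'. x \<in> S \<Longrightarrow> x' \<in> S \<Longrightarrow> \<delta> x x' = 0 \<longleftrightarrow> x = x'"
      "\<And>y y'. y \<in> T \<Longrightarrow> y' \<in> T \<Longrightarrow> \<epsilon> y y' = 0 \<longleftrightarrow> y = y'"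
    and zero: "pgw_sum lam p \<delta> S \<epsilon> T w = 0"
  obtains f where "bij_betw f S T" and "\<And>x x'. x \<in> S \<Longrightarrow> x' \<in> S \<Longrightarrow> \<epsilon> (f x) (f x') = \<delta> x x'"
    and "\<And>x. x \<in> S \<Longrightarrow> b (f x) = a x"
proof -
  from zero have full: "full_coupling S a T b w"
    and iso: "\<And>x y x' y'. x \<in> S \<Longrightarrow> y \<in> T \<Longrightarrow> x' \<in> S \<Longrightarrow> y' \<in> T \<Longrightarrow> w (x, y) \<noteq> 0 \<Longrightarrow> w (x', y') \<noteq> 0
      \<Longrightarrow> \<delta> x x' = \<epsilon> y y'"
    unfolding pgw_sum_eq_0_iff[OF w fin mass lam] by blast+
  have row: "(\<Sum>y\<in>T. w (x, y)) = a x" if "x \<in> S" for x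
    using full that by (simp add: full_coupling_def)
  have col: "(\<Sum>x\<in>S. w (x, y)) = b y" if "y \<in> T" for y
    using full that by (simp add: full_coupling_def)
  have ex1: "\<exists>y\<in>T. w (x, y) \<noteq> 0" if "x \<in> S" for x
    using row[OF that] pos(1)[OF that] by (metis less_irrefl sum.neutral)
  have ex2: "\<exists>x\<in>S. w (x, y) \<noteq> 0" if "y \<in> T" for y
    using col[OF that] pos(2)[OF that] by (metis less_irrefl sum.neutral)
  from ex1 obtain f where f: "\<And>x. x \<in> S \<Longrightarrow> f x \<in> T" "\<And>x. x \<in> S \<Longrightarrow> w (x, f x) \<noteq> 0"
    by metis
  have graph: "x = x' \<longleftrightarrow> y = y'"
    if "x \<in> S" "y \<in> T" "x' \<in> S" "y' \<in> T" "w (x, y) \<noteq> 0" "w (x', y') \<noteq> 0" for x y x' y'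
    using iso[OF that] sep that by metis
  show thesis
  proof (rule that)
    show "bij_betw f S T"
      unfolding bij_betw_def
    proof
      show "inj_on f S" using f graph by (metis inj_onI)
      show "f ` S = T"
      proof
        show "T \<subseteq> f ` S"
        proof
          fix y assume "y \<in> T"
          with ex2 obtain x where "x \<in> S" "w (x, y) \<noteq> 0" by blast
          with f graph[of x y x "f x"] \<open>y \<in> T\<close> show "y \<in> f ` S" by blast
        qed
      qed (use f in blast)
    qed
    show "\<epsilon> (f x) (f x') = \<delta> x x'" if "x \<in> S" "x' \<in> S" for x x'
      using iso[of x "f x" x' "f x'"] f that by metis
    show "b (f x) = a x" if x: "x \<in> S" for x
    proof -
      have "(\<Sum>y\<in>T. w (x, y)) = (\<Sum>y\<in>{f x}. w (x, y))"
        using fin f x graph[of x _ x "f x"] by (intro sum.mono_neutral_right) auto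
      moreover have "(\<Sum>x'\<in>S. w (x', f x)) = (\<Sum>x'\<in>{x}. w (x', f x))"
        using fin f x graph[of _ "f x" x "f x"] by (intro sum.mono_neutral_right) auto
      ultimately show ?thesis using row[OF x] col[OF f(1)[OF x]] by simp
    qed
  qed
qed

text \<open>The coupling concentrated on the graph of the isomorphism has cost zero.\<close>

lemma isomorphic_imp_pgw_sum_eq_0:
  assumes fin: "finite S" "finite T" and mass: "sum a S = 1" "sum b T = 1" and lam: "0 < lam"
    and nonneg: "\<And>x. x \<in> S \<Longrightarrow> 0 \<le> a x"
    and f: "bij_betw f S T" "\<And>x x'. x \<in> S \<Longrightarrow> x' \<in> S \<Longrightarrow> \<epsilon> (f x) (f x') = \<delta> x x'"
      "\<And>x. x \<in> S \<Longrightarrow> b (f x) = a x"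
  obtains w where "sub_coupling S a T b w" and "pgw_sum lam p \<delta> S \<epsilon> T w = 0"
proof -
  define w where "w = (\<lambda>(x, y). if y = f x then a x else 0)"
  have fT: "f x \<in> T" if "x \<in> S" for x using f(1) that by (auto simp: bij_betw_def)
  have "(\<Sum>x\<in>S. w (x, y)) = b y" if y: "y \<in> T" for y
  proof -
    obtain x where x: "x \<in> S" "y = f x" using f(1) y by (auto simp: bij_betw_def)
    have "(\<Sum>x'\<in>S. w (x', y)) = (\<Sum>x'\<in>{x}. w (x', y))"
      using fin x f(1) by (intro sum.mono_neutral_right) (auto simp: w_def bij_betw_def inj_on_def)
    then show ?thesis using x f(3) by (simp add: w_def)
  qed
  then have full: "full_coupling S a T b w"
    using nonneg fT fin by (auto simp: full_coupling_def w_def)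
  then have sub: "sub_coupling S a T b w" by (rule full_coupling_imp_sub_coupling)
  show thesis
    using full f(2) fT
    by (intro that[OF sub], subst pgw_sum_eq_0_iff[OF sub fin mass lam]) (auto simp: w_def split: if_splits)
qed

subsection \<open>The Wasserstein distance of Gaussian measures\<close>

lemma W2_nonneg: "0 \<le> W2 M N"
  by (simp add: W2_def)

lemma W2_self:
  fixes M :: "'a::euclidean_space measure"
  assumes "sets M = sets borel"
  shows "W2 M M = 0"
proof -
  \<comment> \<open>The diagonal coupling transports nothing.\<close>
  define \<pi> where "\<pi> = distr M (M \<Otimes>\<^sub>M M) (\<lambda>x. (x, x))"
  note [measurable_cong] = assms
  have "\<pi> \<in> couplings M M"
    by (simp add: couplings_def \<pi>_def distr_distr comp_def)
  moreover have "(\<integral>\<^sup>+ (x, y). ennreal ((dist x y)\<^sup>2) \<partial>\<pi>) = 0"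
    unfolding \<pi>_def by (subst nn_integral_distr) auto
  ultimately have "(INF \<pi>\<in>couplings M M. \<integral>\<^sup>+ (x, y). ennreal ((dist x y)\<^sup>2) \<partial>\<pi>) = 0"
    by (metis INF_lower le_zero_eq)
  then show ?thesis by (simp add: W2_def)
qed

text \<open>The squared norm is a finite sum of squared coordinates, and each one-dimensional
  projection is normal or Dirac.\<close>

lemma gaussian_measure_second_moment:
  fixes M :: "'a::euclidean_space measure"
  assumes "gaussian_measure M"
  shows "(\<integral>\<^sup>+ x. ennreal ((norm x)\<^sup>2) \<partial>M) < \<infinity>"
proof -
  have [measurable_cong]: "sets M = sets borel" using assms by (simp add: gaussian_measure_def)
  have proj: "(\<integral>\<^sup>+ x. ennreal ((x \<bullet> u)\<^sup>2) \<partial>M) < \<infinity>" for u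
  proof -
    have eq: "(\<integral>\<^sup>+ x. ennreal ((x \<bullet> u)\<^sup>2) \<partial>M) = (\<integral>\<^sup>+ t. ennreal (t\<^sup>2) \<partial>distr M borel (\<lambda>x. x \<bullet> u))"
      by (subst nn_integral_distr) auto
    consider m \<sigma> where "0 < \<sigma>" "distr M borel (\<lambda>x. x \<bullet> u) = density lborel (normal_density m \<sigma>)"
      | m where "distr M borel (\<lambda>x. x \<bullet> u) = return borel m"
      using assms unfolding gaussian_measure_def by blast
    then show ?thesis
    proof cases
      case (1 m \<sigma>)
      \<comment> \<open>Dominates \<open>t\<close> squared by central moments; the exponent 0 is
        kept so that \<open>integrable_normal_moment\<close> covers the constant term as
        well.\<close>
      have int: "integrable lborel (\<lambda>t. 2 * (normal_density m \<sigma> t * (t - m)^2) + 2 * m\<^sup>2 * (normal_density m \<sigma> t * (t - m)^0))"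
        using 1(1) by (intro Bochner_Integration.integrable_add Bochner_Integration.integrable_mult_right
            integrable_normal_moment)
      have le: "normal_density m \<sigma> t * t\<^sup>2 \<le> 2 * (normal_density m \<sigma> t * (t - m)^2) + 2 * m\<^sup>2 * (normal_density m \<sigma> t * (t - m)^0)" for t
      proof -
        have "t\<^sup>2 \<le> 2 * (t - m)\<^sup>2 + 2 * m\<^sup>2"
          using zero_le_power2[of "t - 2 * m"] by (simp add: power2_eq_square algebra_simps)
        from mult_left_mono[OF this normal_density_nonneg[of m \<sigma> t]] show ?thesis
          by (simp add: algebra_simps)
      qed
      have "(\<integral>\<^sup>+ t. ennreal (t\<^sup>2) \<partial>density lborel (normal_density m \<sigma>))
          = (\<integral>\<^sup>+ t. ennreal (normal_density m \<sigma> t * t\<^sup>2) \<partial>lborel)"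
        by (subst nn_integral_density) (auto simp: ennreal_mult)
      also have "\<dots> \<le> (\<integral>\<^sup>+ t. ennreal (2 * (normal_density m \<sigma> t * (t - m)^2) + 2 * m\<^sup>2 * (normal_density m \<sigma> t * (t - m)^0)) \<partial>lborel)"
        by (intro nn_integral_mono ennreal_leI le)
      also have "\<dots> < \<infinity>"
        using int by (subst nn_integral_eq_integral) auto
      finally show ?thesis unfolding eq 1 .
    next
      case (2 m)
      show ?thesis unfolding eq 2 by (subst nn_integral_return) auto
    qed
  qed
  have "(\<integral>\<^sup>+ x. ennreal ((norm x)\<^sup>2) \<partial>M) = (\<integral>\<^sup>+ x. (\<Sum>u\<in>Basis. ennreal ((x \<bullet> u)\<^sup>2)) \<partial>M)"
    by (intro nn_integral_cong)
      (subst power2_norm_eq_inner, subst euclidean_inner, simp add: power2_eq_square)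
  also have "\<dots> = (\<Sum>u\<in>Basis. \<integral>\<^sup>+ x. ennreal ((x \<bullet> u)\<^sup>2) \<partial>M)"
    by (rule nn_integral_sum) simp
  also have "\<dots> < \<infinity>" using proj by simp
  finally show ?thesis .
qed

lemma pair_measure_in_couplings:
  assumes "prob_space M" "prob_space N"
  shows "M \<Otimes>\<^sub>M N \<in> couplings M N"
proof -
  interpret M: prob_space M by fact
  interpret N: prob_space N by fact
  have "distr (M \<Otimes>\<^sub>M N) N snd = N"
  proof (rule measure_eqI)
    fix A assume "A \<in> sets (distr (M \<Otimes>\<^sub>M N) N snd)"
    then have A: "A \<in> sets N" by simp
    then have "snd -` A \<inter> space (M \<Otimes>\<^sub>M N) = space M \<times> A"
      using sets.sets_into_space by (auto simp: space_pair_measure)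
    with A show "emeasure (distr (M \<Otimes>\<^sub>M N) N snd) A = emeasure N A"
      by (simp add: emeasure_distr N.emeasure_pair_measure_Times M.emeasure_space_1)
  qed simp
  then show ?thesis by (simp add: couplings_def N.distr_pair_fst)
qed

text \<open>The product coupling has finite cost. This matters because \<open>enn2real\<close> maps
  infinity to 0: without finiteness, \<open>W2 M N = 0\<close> would not mean that the infimum
  vanishes.\<close>

lemma wasserstein_infimum_finite:
  fixes M N :: "'a::euclidean_space measure"
  assumes prob: "prob_space M" "prob_space N" and sets: "sets M = sets borel" "sets N = sets borel"
    and moment: "(\<integral>\<^sup>+ x. ennreal ((norm x)\<^sup>2) \<partial>M) < \<infinity>" "(\<integral>\<^sup>+ x. ennreal ((norm x)\<^sup>2) \<partial>N) < \<infinity>"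
  shows "(INF \<pi>\<in>couplings M N. \<integral>\<^sup>+ (x, y). ennreal ((dist x y)\<^sup>2) \<partial>\<pi>) < \<infinity>"
proof -
  note [measurable_cong] = sets
  have coup: "M \<Otimes>\<^sub>M N \<in> couplings M N" by (rule pair_measure_in_couplings[OF prob])
  have le: "(dist x y)\<^sup>2 \<le> 2 * (norm x)\<^sup>2 + 2 * (norm y)\<^sup>2" for x y :: 'a
  proof -
    have "(dist x y)\<^sup>2 \<le> (norm x + norm y)\<^sup>2"
      by (intro power_mono) (auto simp: dist_norm norm_triangle_ineq4)
    also have "\<dots> \<le> 2 * (norm x)\<^sup>2 + 2 * (norm y)\<^sup>2"
      using zero_le_power2[of "norm x - norm y"] by (simp add: power2_eq_square algebra_simps)
    finally show ?thesis .
  qed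
  have "(\<integral>\<^sup>+ (x, y). ennreal ((dist x y)\<^sup>2) \<partial>(M \<Otimes>\<^sub>M N))
      \<le> (\<integral>\<^sup>+ z. 2 * ennreal ((norm (fst z))\<^sup>2) + 2 * ennreal ((norm (snd z))\<^sup>2) \<partial>(M \<Otimes>\<^sub>M N))"
  proof (intro nn_integral_mono)
    fix z :: "'a \<times> 'a"
    show "(case z of (x, y) \<Rightarrow> ennreal ((dist x y)\<^sup>2)) \<le> 2 * ennreal ((norm (fst z))\<^sup>2) + 2 * ennreal ((norm (snd z))\<^sup>2)"
      using ennreal_leI[OF le[of "fst z" "snd z"]] by (simp add: case_prod_unfold ennreal_plus ennreal_mult)
  qed
  also have "\<dots> = 2 * (\<integral>\<^sup>+ z. ennreal ((norm (fst z))\<^sup>2) \<partial>(M \<Otimes>\<^sub>M N)) + 2 * (\<integral>\<^sup>+ z. ennreal ((norm (snd z))\<^sup>2) \<partial>(M \<Otimes>\<^sub>M N))"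
    by (simp add: nn_integral_add nn_integral_cmult)
  also have "(\<integral>\<^sup>+ z. ennreal ((norm (fst z))\<^sup>2) \<partial>(M \<Otimes>\<^sub>M N)) = (\<integral>\<^sup>+ x. ennreal ((norm x)\<^sup>2) \<partial>distr (M \<Otimes>\<^sub>M N) M fst)"
    by (subst nn_integral_distr) auto
  also have "distr (M \<Otimes>\<^sub>M N) M fst = M" using coup by (simp add: couplings_def)
  also have "(\<integral>\<^sup>+ z. ennreal ((norm (snd z))\<^sup>2) \<partial>(M \<Otimes>\<^sub>M N)) = (\<integral>\<^sup>+ x. ennreal ((norm x)\<^sup>2) \<partial>distr (M \<Otimes>\<^sub>M N) N snd)"
    by (subst nn_integral_distr) auto
  also have "distr (M \<Otimes>\<^sub>M N) N snd = N" using coup by (simp add: couplings_def)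
  also have "2 * (\<integral>\<^sup>+ x. ennreal ((norm x)\<^sup>2) \<partial>M) + 2 * (\<integral>\<^sup>+ x. ennreal ((norm x)\<^sup>2) \<partial>N) < \<infinity>"
    using moment by (simp add: ennreal_mult_less_top)
  finally show ?thesis
    using INF_lower[OF coup, of "\<lambda>\<pi>. \<integral>\<^sup>+ (x, y). ennreal ((dist x y)\<^sup>2) \<partial>\<pi>"] by (rule le_less_trans[rotated])
qed

text \<open>Markov's inequality: mass that starts in \<open>C\<close> and ends outside its closed
  \<open>r\<close>-neighbourhood travels at least \<open>r\<close>, so it is bounded by the
  transport cost divided by the square of \<open>r\<close>.\<close>

lemma coupling_emeasure_le:
  fixes M N :: "'a::euclidean_space measure"
  assumes sets: "sets M = sets borel" "sets N = sets borel"
    and \<pi>: "\<pi> \<in> couplings M N" and "closed C" "C \<noteq> {}" "0 < r"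
  shows "emeasure M C \<le> emeasure N {y. infdist y C \<le> r}
    + ennreal (1 / r\<^sup>2) * (\<integral>\<^sup>+ (x, y). ennreal ((dist x y)\<^sup>2) \<partial>\<pi>)"
proof -
  define D where "D = {y. infdist y C \<le> r}"
  have [measurable]: "D \<in> sets borel" "C \<in> sets borel"
    unfolding D_def using \<open>closed C\<close>
    by (auto intro!: borel_closed closed_Collect_le continuous_intros)
  note [measurable_cong] = sets
  have [measurable_cong]: "sets \<pi> = sets (M \<Otimes>\<^sub>M N)" and marg: "distr \<pi> M fst = M" "distr \<pi> N snd = N"
    using \<pi> by (auto simp: couplings_def)
  have "emeasure M C = (\<integral>\<^sup>+ x. indicator C x \<partial>distr \<pi> M fst)"
    unfolding marg by (subst nn_integral_indicator) (auto simp: sets)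
  also have "\<dots> = (\<integral>\<^sup>+ z. indicator C (fst z) \<partial>\<pi>)"
    by (subst nn_integral_distr) auto
  also have "\<dots> \<le> (\<integral>\<^sup>+ z. indicator D (snd z) + ennreal (1 / r\<^sup>2) * ennreal ((dist (fst z) (snd z))\<^sup>2) \<partial>\<pi>)"
  proof (intro nn_integral_mono)
    fix z :: "'a \<times> 'a"
    show "indicator C (fst z) \<le> indicator D (snd z) + ennreal (1 / r\<^sup>2) * ennreal ((dist (fst z) (snd z))\<^sup>2)"
    proof (cases "fst z \<in> C \<and> snd z \<notin> D")
      case True
      then have "infdist (snd z) C \<le> dist (snd z) (fst z)" by (intro infdist_le) auto
      with True have "r \<le> dist (fst z) (snd z)" by (simp add: D_def dist_commute)
      then have "r\<^sup>2 \<le> (dist (fst z) (snd z))\<^sup>2" using \<open>0 < r\<close> by (intro power_mono) auto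
      then have "1 \<le> 1 / r\<^sup>2 * (dist (fst z) (snd z))\<^sup>2" using \<open>0 < r\<close> by (simp add: field_simps)
      then have "ennreal 1 \<le> ennreal (1 / r\<^sup>2) * ennreal ((dist (fst z) (snd z))\<^sup>2)"
        by (subst ennreal_mult[symmetric]) (auto intro!: ennreal_leI simp del: ennreal_1)
      with True show ?thesis by simp
    qed (auto simp: indicator_def)
  qed
  also have "\<dots> = (\<integral>\<^sup>+ z. indicator D (snd z) \<partial>\<pi>)
      + ennreal (1 / r\<^sup>2) * (\<integral>\<^sup>+ z. ennreal ((dist (fst z) (snd z))\<^sup>2) \<partial>\<pi>)"
    by (subst nn_integral_add) (auto simp: nn_integral_cmult)
  also have "(\<integral>\<^sup>+ z. indicator D (snd z) \<partial>\<pi>) = (\<integral>\<^sup>+ y. indicator D y \<partial>distr \<pi> N snd)"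
    by (subst nn_integral_distr) auto
  also have "\<dots> = emeasure N D" unfolding marg by (subst nn_integral_indicator) (auto simp: sets)
  finally show ?thesis by (simp add: D_def case_prod_unfold)
qed

text \<open>Couplings of arbitrarily small cost are enough, so no optimal coupling has to be
  constructed. They compare \<open>M\<close> and \<open>N\<close> on closed sets, inner regularity
  passes to Borel sets, and complements turn the inequality into equality.\<close>

lemma W2_eq_0_imp_eq:
  fixes M N :: "'a::euclidean_space measure"
  assumes prob: "prob_space M" "prob_space N" and sets: "sets M = sets borel" "sets N = sets borel"
    and moment: "(\<integral>\<^sup>+ x. ennreal ((norm x)\<^sup>2) \<partial>M) < \<infinity>" "(\<integral>\<^sup>+ x. ennreal ((norm x)\<^sup>2) \<partial>N) < \<infinity>"
    and "W2 M N = 0"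
  shows "M = N"
proof -
  interpret M: prob_space M by fact
  interpret N: prob_space N by fact
  let ?J = "\<lambda>\<pi>. \<integral>\<^sup>+ (x, y). ennreal ((dist x y)\<^sup>2) \<partial>\<pi>"
  have "(INF \<pi>\<in>couplings M N. ?J \<pi>) = 0"
    using \<open>W2 M N = 0\<close> wasserstein_infimum_finite[OF prob sets moment]
    by (auto simp: W2_def enn2real_eq_0_iff)
  have near: "emeasure M C \<le> emeasure N {y. infdist y C \<le> r}"
    if C: "closed C" "C \<noteq> {}" "0 < r" for C and r :: real
  proof (rule ennreal_le_epsilon)
    fix e :: real assume "0 < e"
    \<comment> \<open>The factor \<open>r\<^sup>2\<close> cancels the one in Markov's inequality and
      leaves the error \<open>e\<close>.\<close>
    then have "(INF \<pi>\<in>couplings M N. ?J \<pi>) < ennreal (e * r\<^sup>2)"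
      unfolding \<open>(INF \<pi>\<in>couplings M N. ?J \<pi>) = 0\<close> using C by simp
    then obtain \<pi> where \<pi>: "\<pi> \<in> couplings M N" "?J \<pi> < ennreal (e * r\<^sup>2)"
      unfolding INF_less_iff by blast
    have "ennreal (1 / r\<^sup>2) * ?J \<pi> \<le> ennreal (1 / r\<^sup>2) * ennreal (e * r\<^sup>2)"
      using \<pi> by (intro mult_left_mono) auto
    also have "\<dots> = ennreal e"
      using C \<open>0 < e\<close> by (subst ennreal_mult[symmetric]) auto
    finally have "emeasure N {y. infdist y C \<le> r} + ennreal (1 / r\<^sup>2) * ?J \<pi> \<le> emeasure N {y. infdist y C \<le> r} + ennreal e"
      by (rule add_left_mono)
    with coupling_emeasure_le[OF sets \<pi>(1) C]
    show "emeasure M C \<le> emeasure N {y. infdist y C \<le> r} + ennreal e" by (rule order_trans)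
  qed
  have closed_le: "emeasure M C \<le> emeasure N C" if "closed C" for C
  proof (cases "C = {}")
    case False
    \<comment> \<open>Closed neighbourhoods that shrink to \<open>C\<close>, since \<open>C\<close>
      is closed and nonempty; continuity from above then removes the radius.\<close>
    define A where "A n = {y. infdist y C \<le> 1 / Suc n}" for n
    have "closed (A n)" for n
      unfolding A_def by (intro closed_Collect_le continuous_intros)
    then have "range A \<subseteq> sets N" by (auto simp: sets)
    moreover have "decseq A"
      unfolding decseq_def A_def by (auto elim!: order_trans intro!: frac_le)
    moreover have "(\<Inter>n. A n) = C"
    proof
      show "(\<Inter>n. A n) \<subseteq> C"
      proof
        fix y assume y: "y \<in> (\<Inter>n. A n)"
        have "infdist y C \<le> 0"
        proof (rule ccontr)
          assume "\<not> infdist y C \<le> 0"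
          then obtain n where "inverse (real (Suc n)) < infdist y C"
            using reals_Archimedean[of "infdist y C"] by auto
          moreover have "infdist y C \<le> 1 / Suc n" using y by (auto simp: A_def)
          ultimately show False by (simp add: inverse_eq_divide)
        qed
        then show "y \<in> C"
          using in_closed_iff_infdist_zero[OF that False] infdist_nonneg[of y C] by force
      qed
      show "C \<subseteq> (\<Inter>n. A n)" by (auto simp: A_def)
    qed
    ultimately have "(\<lambda>n. emeasure N (A n)) \<longlonglongrightarrow> emeasure N C"
      using Lim_emeasure_decseq[of A N] by simp
    then show ?thesis
      by (rule LIMSEQ_le_const) (auto intro!: near[OF that False] simp: A_def)
  qed simp
  have le: "emeasure M B \<le> emeasure N B" if "B \<in> sets borel" for B
  proof -
    have "emeasure M B = (SUP K\<in>{K. K \<subseteq> B \<and> compact K}. emeasure M K)"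
      using that by (intro inner_regular) (auto simp: sets)
    also have "\<dots> \<le> emeasure N B"
    proof (rule SUP_least)
      fix K assume K: "K \<in> {K. K \<subseteq> B \<and> compact K}"
      then have "emeasure M K \<le> emeasure N K" by (auto intro: closed_le compact_imp_closed)
      also have "\<dots> \<le> emeasure N B" using K that by (intro emeasure_mono) (auto simp: sets)
      finally show "emeasure M K \<le> emeasure N B" .
    qed
    finally show ?thesis .
  qed
  show ?thesis
  proof (rule measure_eqI)
    fix B assume B: "B \<in> sets M"
    have space: "space M = space N" using sets sets_eq_imp_space_eq by metis
    \<comment> \<open>Both measures have mass 1, so the inequality for the complement is the reverse
      inequality for \<open>B\<close>.\<close>
    have "measure M B \<le> measure N B" "measure M (space M - B) \<le> measure N (space N - B)"
      using le[of B] le[of "space M - B"] B space sets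
      by (auto simp: M.emeasure_eq_measure N.emeasure_eq_measure)
    then have "measure M B = measure N B"
      using M.prob_compl[of B] N.prob_compl[of B] B sets by auto
    then show "emeasure M B = emeasure N B"
      by (simp add: M.emeasure_eq_measure N.emeasure_eq_measure)
  qed (simp add: sets)
qed

lemma gaussian_W2_eq_0_iff:
  assumes "gaussian_measure M" "gaussian_measure N"
  shows "W2 M N = 0 \<longleftrightarrow> M = N"
  using assms W2_self W2_eq_0_imp_eq gaussian_measure_second_moment
  unfolding gaussian_measure_def by metis

subsection \<open>Finite metric measure spaces\<close>

locale finite_prob_space = prob_space M for M :: "'a measure" +
  assumes finite_space: "finite (space M)" and sets_eq_Pow: "sets M = Pow (space M)"
begin

abbreviation mass :: "'a \<Rightarrow> real" where "mass x \<equiv> measure M {x}"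

lemma sum_mass: "sum mass (space M) = 1"
  using finite_measure_eq_sum_singleton[OF finite_space] prob_space by (simp add: sets_eq_Pow)

end

lemma integral_finite_discrete:
  fixes f :: "'a \<Rightarrow> real"
  assumes "finite_measure P" "finite (space P)" "sets P = Pow (space P)"
  shows "(\<integral>x. f x \<partial>P) = (\<Sum>x\<in>space P. f x * measure P {x})"
proof -
  interpret finite_measure P by fact
  have "P = point_measure (space P) (\<lambda>x. ennreal (measure P {x}))"
    using assms by (intro measure_eqI_finite[of _ "space P"])
      (auto simp: sets_point_measure emeasure_point_measure_finite emeasure_eq_measure)
  then have "(\<integral>x. f x \<partial>P) = (\<integral>x. f x \<partial>point_measure (space P) (\<lambda>x. measure P {x}))"
    by simp
  also have "\<dots> = (\<Sum>x\<in>space P. measure P {x} *\<^sub>R f x)"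
    using assms by (subst lebesgue_integral_point_measure_finite) auto
  finally show ?thesis by (simp add: mult.commute)
qed

lemma sets_pair_measure_finite:
  assumes "finite (space M)" "sets M = Pow (space M)" "finite (space N)" "sets N = Pow (space N)"
  shows "sets (M \<Otimes>\<^sub>M N) = Pow (space M \<times> space N)"
proof -
  have "sets (M \<Otimes>\<^sub>M N) = sets (count_space (space M) \<Otimes>\<^sub>M count_space (space N))"
    using assms by (intro sets_pair_measure_cong) auto
  then show ?thesis
    using assms by (subst (asm) pair_measure_countable) (simp_all add: countable_finite)
qed

lemma integral_pair_finite_discrete:
  fixes f :: "'a \<times> 'a \<Rightarrow> real"
  assumes fm: "finite_measure P" and P: "finite (space P)" "sets P = Pow (space P)"
  shows "(\<integral>x. f x \<partial>(P \<Otimes>\<^sub>M P))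
    = (\<Sum>z\<in>space P. \<Sum>z'\<in>space P. f (z, z') * (measure P {z} * measure P {z'}))"
proof -
  interpret finite_measure P by fact
  interpret PP: pair_sigma_finite P P ..
  have fin2: "finite_measure (P \<Otimes>\<^sub>M P)" by (rule finite_measure_pair_measure) fact+
  have single: "measure (P \<Otimes>\<^sub>M P) {(z, z')} = measure P {z} * measure P {z'}"
    if "z \<in> space P" "z' \<in> space P" for z z'
  proof -
    have "emeasure (P \<Otimes>\<^sub>M P) ({z} \<times> {z'}) = emeasure P {z} * emeasure P {z'}"
      using that P by (intro emeasure_pair_measure_Times) auto
    then show ?thesis by (simp add: measure_def enn2real_mult)
  qed
  have "(\<integral>x. f x \<partial>(P \<Otimes>\<^sub>M P)) = (\<Sum>x\<in>space P \<times> space P. f x * measure (P \<Otimes>\<^sub>M P) {x})"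
    using integral_finite_discrete[OF fin2] P sets_pair_measure_finite[OF P P]
    by (simp add: space_pair_measure)
  also have "\<dots> = (\<Sum>x\<in>space P \<times> space P. f x * (measure P {fst x} * measure P {snd x}))"
    by (intro sum.cong refl) (auto simp: single)
  finally show ?thesis by (simp add: sum.cartesian_product case_prod_unfold)
qed

section \<open>Coupling measures on finite spaces as matrices\<close>

locale finite_prob_pair = M: finite_prob_space M + N: finite_prob_space N
  for M :: "'a measure" and N :: "'b measure"
begin

abbreviation "S \<equiv> space M"
abbreviation "T \<equiv> space N"

definition weights :: "('a \<times> 'b) measure \<Rightarrow> 'a \<times> 'b \<Rightarrow> real" where
  "weights \<gamma> z = measure \<gamma> {z}"

text \<open>Since \<open>ennreal\<close> truncates negative entries to 0, this inverts
  \<open>weights\<close> only on nonnegative matrices.\<close>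

definition coupling_of :: "('a \<times> 'b \<Rightarrow> real) \<Rightarrow> ('a \<times> 'b) measure" where
  "coupling_of w = point_measure (S \<times> T) (\<lambda>z. ennreal (w z))"

lemma sets_prod: "sets (M \<Otimes>\<^sub>M N) = Pow (S \<times> T)"
  by (intro sets_pair_measure_finite M.finite_space M.sets_eq_Pow N.finite_space N.sets_eq_Pow)

lemma discrete_coupling:
  assumes "finite_measure \<gamma>" and sets: "sets \<gamma> = sets (M \<Otimes>\<^sub>M N)"
  shows "space \<gamma> = S \<times> T" "finite (space \<gamma>)" "sets \<gamma> = Pow (space \<gamma>)"
    and "A \<subseteq> S \<Longrightarrow> emeasure (distr \<gamma> M fst) A = (\<Sum>x\<in>A. \<Sum>y\<in>T. weights \<gamma> (x, y))"
    and "B \<subseteq> T \<Longrightarrow> emeasure (distr \<gamma> N snd) B = (\<Sum>y\<in>B. \<Sum>x\<in>S. weights \<gamma> (x, y))"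
proof -
  interpret finite_measure \<gamma> by fact
  show space: "space \<gamma> = S \<times> T"
    using sets_eq_imp_space_eq[OF sets] by (simp add: space_pair_measure)
  show fin: "finite (space \<gamma>)" using M.finite_space N.finite_space by (simp add: space)
  show Pow: "sets \<gamma> = Pow (space \<gamma>)" using sets by (simp add: sets_prod space)
  have eq: "emeasure \<gamma> C = (\<Sum>z\<in>C. weights \<gamma> z)" if "C \<subseteq> S \<times> T" for C
    unfolding emeasure_eq_measure weights_def using that fin
    by (subst finite_measure_eq_sum_singleton) (auto simp: Pow space intro: finite_subset)
  show "emeasure (distr \<gamma> M fst) A = (\<Sum>x\<in>A. \<Sum>y\<in>T. weights \<gamma> (x, y))" if "A \<subseteq> S"
  proof -
    have "fst \<in> measurable \<gamma> M" by (auto simp: measurable_def Pow space)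
    then have "emeasure (distr \<gamma> M fst) A = emeasure \<gamma> (A \<times> T)"
      using that by (subst emeasure_distr) (auto simp: M.sets_eq_Pow space intro!: arg_cong[where f = "emeasure \<gamma>"])
    with that eq[of "A \<times> T"] show ?thesis by (auto simp: sum.cartesian_product)
  qed
  show "emeasure (distr \<gamma> N snd) B = (\<Sum>y\<in>B. \<Sum>x\<in>S. weights \<gamma> (x, y))" if "B \<subseteq> T"
  proof -
    have "snd \<in> measurable \<gamma> N" by (auto simp: measurable_def Pow space)
    then have "emeasure (distr \<gamma> N snd) B = emeasure \<gamma> (S \<times> B)"
      using that by (subst emeasure_distr) (auto simp: N.sets_eq_Pow space intro!: arg_cong[where f = "emeasure \<gamma>"])
    with that eq[of "S \<times> B"] show ?thesis by (auto simp: sum_columns)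
  qed
qed

text \<open>On a finite discrete space every measure is additive over singletons, so setwise
  domination of the marginals reduces to the row and column inequalities.\<close>

lemma partial_couplings_iff:
  "\<gamma> \<in> partial_couplings M N \<longleftrightarrow> finite_measure \<gamma> \<and> sets \<gamma> = sets (M \<Otimes>\<^sub>M N)
    \<and> sub_coupling S M.mass T N.mass (weights \<gamma>)"
proof -
  have "(distr \<gamma> M fst \<le> M \<and> distr \<gamma> N snd \<le> N) \<longleftrightarrow> sub_coupling S M.mass T N.mass (weights \<gamma>)"
    if fm: "finite_measure \<gamma>" and sets: "sets \<gamma> = sets (M \<Otimes>\<^sub>M N)"
  proof -
    note D = discrete_coupling[OF fm sets]
    have w0: "0 \<le> weights \<gamma> z" for z by (simp add: weights_def)
    have M: "distr \<gamma> M fst \<le> M \<longleftrightarrow> (\<forall>x\<in>S. (\<Sum>y\<in>T. weights \<gamma> (x, y)) \<le> M.mass x)" (is "?l \<longleftrightarrow> ?r")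
    proof
      assume ?l
      show ?r
      proof
        fix x assume "x \<in> S"
        from le_measureD3[OF \<open>?l\<close>, of "{x}"] D(4)[of "{x}"] \<open>x \<in> S\<close>
        have "ennreal (\<Sum>y\<in>T. weights \<gamma> (x, y)) \<le> ennreal (M.mass x)" by (simp add: M.emeasure_eq_measure)
        then show "(\<Sum>y\<in>T. weights \<gamma> (x, y)) \<le> M.mass x" by (simp add: ennreal_le_iff)
      qed
    next
      assume r: ?r
      have "emeasure (distr \<gamma> M fst) A \<le> emeasure M A" for A
      proof (cases "A \<in> sets M")
        case True
        then have A: "A \<subseteq> S" by (simp add: M.sets_eq_Pow)
        have "emeasure M A = ennreal (\<Sum>x\<in>A. M.mass x)"
          unfolding M.emeasure_eq_measure using A M.finite_space
          by (subst M.finite_measure_eq_sum_singleton) (auto simp: M.sets_eq_Pow intro: finite_subset)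
        then show ?thesis
          unfolding D(4)[OF A] using r A by (auto intro!: ennreal_leI sum_mono)
      qed (simp add: emeasure_notin_sets)
      \<comment> \<open>The order on measures compares spaces and \<sigma>-algebras before values;
        the first two agree here, and off the \<sigma>-algebra both values are 0.\<close>
      then show ?l by (simp add: le_measure_iff le_fun_def)
    qed
    have N: "distr \<gamma> N snd \<le> N \<longleftrightarrow> (\<forall>y\<in>T. (\<Sum>x\<in>S. weights \<gamma> (x, y)) \<le> N.mass y)" (is "?l \<longleftrightarrow> ?r")
    proof
      assume ?l
      show ?r
      proof
        fix y assume "y \<in> T"
        from le_measureD3[OF \<open>?l\<close>, of "{y}"] D(5)[of "{y}"] \<open>y \<in> T\<close>
        have "ennreal (\<Sum>x\<in>S. weights \<gamma> (x, y)) \<le> ennreal (N.mass y)" by (simp add: N.emeasure_eq_measure)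
        then show "(\<Sum>x\<in>S. weights \<gamma> (x, y)) \<le> N.mass y" by (simp add: ennreal_le_iff)
      qed
    next
      assume r: ?r
      have "emeasure (distr \<gamma> N snd) A \<le> emeasure N A" for A
      proof (cases "A \<in> sets N")
        case True
        then have A: "A \<subseteq> T" by (simp add: N.sets_eq_Pow)
        have "emeasure N A = ennreal (\<Sum>y\<in>A. N.mass y)"
          unfolding N.emeasure_eq_measure using A N.finite_space
          by (subst N.finite_measure_eq_sum_singleton) (auto simp: N.sets_eq_Pow intro: finite_subset)
        then show ?thesis
          unfolding D(5)[OF A] using r A by (auto intro!: ennreal_leI sum_mono)
      qed (simp add: emeasure_notin_sets)
      then show ?l by (simp add: le_measure_iff le_fun_def)
    qed
    show ?thesis unfolding M N sub_coupling_def using w0 by simp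
  qed
  then show ?thesis unfolding partial_couplings_def by auto
qed

text \<open>Finiteness is not part of \<open>couplings\<close>; it follows because the first
  marginal is a probability measure.\<close>

lemma couplings_iff:
  "\<gamma> \<in> couplings M N \<longleftrightarrow> finite_measure \<gamma> \<and> sets \<gamma> = sets (M \<Otimes>\<^sub>M N)
    \<and> full_coupling S M.mass T N.mass (weights \<gamma>)"
proof -
  have "finite_measure \<gamma>" if sets: "sets \<gamma> = sets (M \<Otimes>\<^sub>M N)" and marg: "distr \<gamma> M fst = M"
  proof -
    have "fst \<in> measurable \<gamma> M"
      using measurable_fst measurable_cong_sets[OF sets refl] by blast
    moreover from this have "fst -` S \<inter> space \<gamma> = space \<gamma>" by (auto dest: measurable_space)
    moreover have "emeasure (distr \<gamma> M fst) S = 1" unfolding marg by (rule M.emeasure_space_1)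
    ultimately have "emeasure \<gamma> (space \<gamma>) = 1" by (simp add: emeasure_distr)
    then show ?thesis by (intro finite_measureI) simp
  qed
  moreover have "(distr \<gamma> M fst = M \<and> distr \<gamma> N snd = N) \<longleftrightarrow> full_coupling S M.mass T N.mass (weights \<gamma>)"
    if fm: "finite_measure \<gamma>" and sets: "sets \<gamma> = sets (M \<Otimes>\<^sub>M N)"
  proof -
    note D = discrete_coupling[OF fm sets]
    have w0: "0 \<le> weights \<gamma> z" for z by (simp add: weights_def)
    have M: "distr \<gamma> M fst = M \<longleftrightarrow> (\<forall>x\<in>S. emeasure (distr \<gamma> M fst) {x} = emeasure M {x})"
      using measure_eqI_finite[of "distr \<gamma> M fst" S M] M.finite_space by (auto simp: M.sets_eq_Pow)
    have N: "distr \<gamma> N snd = N \<longleftrightarrow> (\<forall>y\<in>T. emeasure (distr \<gamma> N snd) {y} = emeasure N {y})"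
      using measure_eqI_finite[of "distr \<gamma> N snd" T N] N.finite_space by (auto simp: N.sets_eq_Pow)
    show ?thesis
      unfolding M N full_coupling_def using w0 D(4)[of "{x}" for x] D(5)[of "{x}" for x]
      by (simp add: M.emeasure_eq_measure N.emeasure_eq_measure sum_nonneg)
  qed
  ultimately show ?thesis unfolding couplings_def by blast
qed

lemma coupling_of:
  shows "finite_measure (coupling_of w)" "sets (coupling_of w) = sets (M \<Otimes>\<^sub>M N)"
    and "(\<And>z. z \<in> S \<times> T \<Longrightarrow> 0 \<le> w z) \<Longrightarrow> z \<in> S \<times> T \<Longrightarrow> weights (coupling_of w) z = w z"
proof -
  have fin: "finite (S \<times> T)" using M.finite_space N.finite_space by simp
  show "finite_measure (coupling_of w)"
    by (intro finite_measureI)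
      (use fin in \<open>simp add: coupling_of_def space_point_measure emeasure_point_measure_finite less_top\<close>)
  show "sets (coupling_of w) = sets (M \<Otimes>\<^sub>M N)"
    by (simp add: coupling_of_def sets_point_measure sets_prod)
  show "weights (coupling_of w) z = w z" if "\<And>z. z \<in> S \<times> T \<Longrightarrow> 0 \<le> w z" "z \<in> S \<times> T"
    using that by (simp add: weights_def coupling_of_def measure_def emeasure_point_measure_finite[OF fin])
qed

lemma sub_coupling_measure:
  assumes "sub_coupling S M.mass T N.mass w"
  obtains \<gamma> where "\<gamma> \<in> partial_couplings M N" "\<And>z. z \<in> S \<times> T \<Longrightarrow> weights \<gamma> z = w z"
proof (rule that)
  have nonneg: "0 \<le> w z" if "z \<in> S \<times> T" for z
    using assms that unfolding sub_coupling_def by blast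
  show eq: "weights (coupling_of w) z = w z" if "z \<in> S \<times> T" for z
    using nonneg that by (rule coupling_of)
  have "sub_coupling S M.mass T N.mass (weights (coupling_of w))"
    using assms by (subst sub_coupling_cong[OF eq])
  then show "coupling_of w \<in> partial_couplings M N"
    unfolding partial_couplings_iff by (simp add: coupling_of)
qed

lemma couplings_subset_partial_couplings: "couplings M N \<subseteq> partial_couplings M N"
  by (auto simp: couplings_iff partial_couplings_iff intro: full_coupling_imp_sub_coupling)

lemma pgw_objective_eq:
  assumes "\<gamma> \<in> partial_couplings M N"
  shows "pgw_objective lam p q dX M dY N \<gamma> =
    pgw_sum lam p (\<lambda>x x'. dX x x' powr q) S (\<lambda>y y'. dY y y' powr q) T (weights \<gamma>)"
proof -
  have fm: "finite_measure \<gamma>" and sets: "sets \<gamma> = sets (M \<Otimes>\<^sub>M N)"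
    using assms by (auto simp: partial_couplings_iff)
  note D = discrete_coupling[OF fm sets]
  show ?thesis
    unfolding pgw_objective_def pgw_sum_def integral_pair_finite_discrete[OF fm D(2,3)]
    unfolding D(1) M.prob_space N.prob_space
    by (simp add: gw_cost_def weights_def case_prod_unfold)
qed

text \<open>A balanced coupling has mass 1, so the terms with \<open>lam\<close> cancel, whatever
  \<open>lam\<close> is.\<close>

lemma gw_objective_eq:
  assumes "\<gamma> \<in> couplings M N"
  shows "gw_objective p q dX dY \<gamma> = pgw_objective lam p q dX M dY N \<gamma>"
proof -
  have fm: "finite_measure \<gamma>" and sets: "sets \<gamma> = sets (M \<Otimes>\<^sub>M N)"
    and full: "full_coupling S M.mass T N.mass (weights \<gamma>)"
    using assms by (auto simp: couplings_iff)
  note D = discrete_coupling[OF fm sets]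
  have "\<gamma> \<in> partial_couplings M N" using assms couplings_subset_partial_couplings by blast
  moreover have "sum (weights \<gamma>) (S \<times> T) = 1"
    using full_coupling_mass[OF full] M.sum_mass by simp
  ultimately have "pgw_objective lam p q dX M dY N \<gamma> = (\<Sum>z\<in>S \<times> T. \<Sum>z'\<in>S \<times> T.
      \<bar>dX (fst z) (fst z') powr q - dY (snd z) (snd z') powr q\<bar> powr p * (weights \<gamma> z * weights \<gamma> z'))"
    by (simp add: pgw_objective_eq pgw_sum_eq)
  also have "\<dots> = gw_objective p q dX dY \<gamma>"
    unfolding gw_objective_def integral_pair_finite_discrete[OF fm D(2,3)]
    unfolding D(1) by (simp add: gw_cost_def weights_def case_prod_unfold)
  finally show ?thesis ..
qed

end

section \<open>The partial Gromov-Wasserstein distance of finite probability spaces\<close>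

context finite_prob_pair
begin

lemma PGW_minimizer:
  obtains \<gamma> where "\<gamma> \<in> partial_couplings M N"
    and "\<And>\<gamma>'. \<gamma>' \<in> partial_couplings M N
      \<Longrightarrow> pgw_objective lam p q dX M dY N \<gamma> \<le> pgw_objective lam p q dX M dY N \<gamma>'"
    and "(INF \<gamma>\<in>partial_couplings M N. pgw_objective lam p q dX M dY N \<gamma>) = pgw_objective lam p q dX M dY N \<gamma>"
proof -
  let ?F = "pgw_sum lam p (\<lambda>x x'. dX x x' powr q) S (\<lambda>y y'. dY y y' powr q) T"
  obtain w where w: "sub_coupling S M.mass T N.mass w"
      "\<And>w'. sub_coupling S M.mass T N.mass w' \<Longrightarrow> ?F w \<le> ?F w'"
    by (rule pgw_sum_minimizer[OF M.finite_space N.finite_space M.sum_mass, where b = N.mass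
          and lam = lam and p = p and \<delta> = "\<lambda>x x'. dX x x' powr q" and \<epsilon> = "\<lambda>y y'. dY y y' powr q"])
      auto
  obtain \<gamma> where \<gamma>: "\<gamma> \<in> partial_couplings M N" "\<And>z. z \<in> S \<times> T \<Longrightarrow> weights \<gamma> z = w z"
    using sub_coupling_measure[OF w(1)] by blast
  have obj: "pgw_objective lam p q dX M dY N \<gamma> = ?F w"
    unfolding pgw_objective_eq[OF \<gamma>(1)] by (rule pgw_sum_cong) (rule \<gamma>(2))
  have min: "pgw_objective lam p q dX M dY N \<gamma> \<le> pgw_objective lam p q dX M dY N \<gamma>'"
    if "\<gamma>' \<in> partial_couplings M N" for \<gamma>'
    unfolding obj pgw_objective_eq[OF that] using that by (intro w(2)) (simp add: partial_couplings_iff)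
  show thesis
    by (rule that[OF \<gamma>(1) min]) (use \<gamma>(1) min in \<open>auto intro!: cInf_eq_minimum\<close>)
qed

lemma PGW_attained:
  obtains w where "sub_coupling S M.mass T N.mass w"
    and "PGW lam p q dX M dY N
      = pgw_sum lam p (\<lambda>x x'. dX x x' powr q) S (\<lambda>y y'. dY y y' powr q) T w powr (1 / p)"
proof (rule PGW_minimizer)
  fix \<gamma> assume "\<gamma> \<in> partial_couplings M N"
    and "(INF \<gamma>\<in>partial_couplings M N. pgw_objective lam p q dX M dY N \<gamma>) = pgw_objective lam p q dX M dY N \<gamma>"
  then show thesis
    by (intro that[of "weights \<gamma>"]) (auto simp: PGW_def partial_couplings_iff pgw_objective_eq)
qed

lemma pgw_sum_nonneg:
  assumes "sub_coupling S M.mass T N.mass w" "0 \<le> lam"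
  shows "0 \<le> pgw_sum lam p \<delta> S \<epsilon> T w"
proof -
  have "(sum w (S \<times> T))\<^sup>2 \<le> 1"
    using sub_coupling_mass[OF assms(1) M.sum_mass] by (auto simp: power_le_one)
  then have "0 \<le> 2 * lam * (1 - (sum w (S \<times> T))\<^sup>2)" using assms(2) by simp
  also have "\<dots> \<le> pgw_sum lam p \<delta> S \<epsilon> T w" by (rule pgw_sum_ge[OF assms(1)])
  finally show ?thesis .
qed

lemma PGW_le:
  assumes w: "sub_coupling S M.mass T N.mass w" and "1 \<le> p" "0 \<le> lam"
  shows "PGW lam p q dX M dY N
    \<le> pgw_sum lam p (\<lambda>x x'. dX x x' powr q) S (\<lambda>y y'. dY y y' powr q) T w powr (1 / p)"
proof (rule PGW_minimizer[of lam p q dX dY])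
  let ?I = "INF \<gamma>\<in>partial_couplings M N. pgw_objective lam p q dX M dY N \<gamma>"
  fix \<gamma> assume \<gamma>: "\<gamma> \<in> partial_couplings M N"
    "\<And>\<gamma>'. \<gamma>' \<in> partial_couplings M N
      \<Longrightarrow> pgw_objective lam p q dX M dY N \<gamma> \<le> pgw_objective lam p q dX M dY N \<gamma>'"
    "?I = pgw_objective lam p q dX M dY N \<gamma>"
  obtain \<gamma>' where \<gamma>': "\<gamma>' \<in> partial_couplings M N" "\<And>z. z \<in> S \<times> T \<Longrightarrow> weights \<gamma>' z = w z"
    using sub_coupling_measure[OF w] by blast
  have "?I \<le> pgw_objective lam p q dX M dY N \<gamma>'" unfolding \<gamma>(3) by (rule \<gamma>(2)[OF \<gamma>'(1)])
  also have "\<dots> = pgw_sum lam p (\<lambda>x x'. dX x x' powr q) S (\<lambda>y y'. dY y y' powr q) T w"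
    unfolding pgw_objective_eq[OF \<gamma>'(1)] by (rule pgw_sum_cong) (rule \<gamma>'(2))
  finally have "?I \<le> pgw_sum lam p (\<lambda>x x'. dX x x' powr q) S (\<lambda>y y'. dY y y' powr q) T w" .
  \<comment> \<open>Monotonicity of \<open>powr\<close> is available only for nonnegative
    bases.\<close>
  moreover have "0 \<le> ?I"
    unfolding \<gamma>(3) pgw_objective_eq[OF \<gamma>(1)]
    using \<gamma>(1) \<open>0 \<le> lam\<close> by (intro pgw_sum_nonneg) (auto simp: partial_couplings_iff)
  ultimately show ?thesis
    unfolding PGW_def using \<open>1 \<le> p\<close> by (intro powr_mono2) auto
qed

text \<open>Completing a minimizer to a balanced coupling does not raise the objective, so the
  completion is again a minimizer. Balanced couplings are partial ones with the same objective,
  hence the two infima coincide.\<close>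

lemma PGW_eq_GW:
  assumes cost: "\<And>x x' y y'. x \<in> S \<Longrightarrow> x' \<in> S \<Longrightarrow> y \<in> T \<Longrightarrow> y' \<in> T
      \<Longrightarrow> \<bar>dX x x' powr q - dY y y' powr q\<bar> powr p \<le> 2 * lam"
  shows "PGW lam p q dX M dY N = GW p q dX M dY N"
proof (rule PGW_minimizer[of lam p q dX dY])
  fix \<gamma> assume \<gamma>: "\<gamma> \<in> partial_couplings M N"
    "\<And>\<gamma>'. \<gamma>' \<in> partial_couplings M N
      \<Longrightarrow> pgw_objective lam p q dX M dY N \<gamma> \<le> pgw_objective lam p q dX M dY N \<gamma>'"
    "(INF \<gamma>\<in>partial_couplings M N. pgw_objective lam p q dX M dY N \<gamma>) = pgw_objective lam p q dX M dY N \<gamma>"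
  then have w: "sub_coupling S M.mass T N.mass (weights \<gamma>)" by (simp add: partial_couplings_iff)
  obtain w' where w': "full_coupling S M.mass T N.mass w'" "\<And>z. z \<in> S \<times> T \<Longrightarrow> weights \<gamma> z \<le> w' z"
    using sub_coupling_extends_to_full[OF M.finite_space N.finite_space M.sum_mass N.sum_mass w] by blast
  have sub: "sub_coupling S M.mass T N.mass w'" by (rule full_coupling_imp_sub_coupling) fact
  obtain \<gamma>' where \<gamma>': "\<gamma>' \<in> partial_couplings M N" "\<And>z. z \<in> S \<times> T \<Longrightarrow> weights \<gamma>' z = w' z"
    using sub_coupling_measure[OF sub] by blast
  have "sum (weights \<gamma>') (S \<times> T) = sum w' (S \<times> T)" using \<gamma>'(2) by (rule sum.cong[OF refl])
  also have "\<dots> = 1" using full_coupling_mass[OF w'(1)] M.sum_mass by simp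
  finally have "full_coupling S M.mass T N.mass (weights \<gamma>')"
    using \<gamma>'(1) sub_coupling_full_iff[OF M.finite_space N.finite_space M.sum_mass N.sum_mass]
    by (simp add: partial_couplings_iff)
  then have coup: "\<gamma>' \<in> couplings M N"
    using \<gamma>'(1) by (simp add: couplings_iff partial_couplings_iff)
  have "pgw_objective lam p q dX M dY N \<gamma>' \<le> pgw_objective lam p q dX M dY N \<gamma>"
    unfolding pgw_objective_eq[OF \<gamma>(1)] pgw_objective_eq[OF \<gamma>'(1)]
    using w w'(2) \<gamma>'(2) by (intro pgw_sum_antimono cost) (auto simp: weights_def)
  then have eq: "gw_objective p q dX dY \<gamma>' = pgw_objective lam p q dX M dY N \<gamma>"
    using \<gamma>(2)[OF \<gamma>'(1)] gw_objective_eq[OF coup, of p q dX dY lam] by simp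
  have "(INF \<gamma>\<in>couplings M N. gw_objective p q dX dY \<gamma>) = pgw_objective lam p q dX M dY N \<gamma>"
  proof (rule cInf_eq_minimum)
    show "pgw_objective lam p q dX M dY N \<gamma> \<in> gw_objective p q dX dY ` couplings M N"
      using coup eq by (metis image_eqI)
    fix r assume "r \<in> gw_objective p q dX dY ` couplings M N"
    then obtain \<gamma>'' where c: "\<gamma>'' \<in> couplings M N" "r = gw_objective p q dX dY \<gamma>''" by blast
    then have "\<gamma>'' \<in> partial_couplings M N" using couplings_subset_partial_couplings by blast
    from \<gamma>(2)[OF this] show "pgw_objective lam p q dX M dY N \<gamma> \<le> r"
      using gw_objective_eq[OF c(1), of p q dX dY lam] c(2) by simp
  qed
  then show ?thesis by (simp add: PGW_def GW_def \<gamma>(3))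
qed

lemma PGW_eq_0_iff_strongly_isomorphic:
  assumes p: "1 \<le> p" "1 \<le> q" and lam: "0 < lam"
    and pos: "\<And>x. x \<in> S \<Longrightarrow> 0 < M.mass x" "\<And>y. y \<in> T \<Longrightarrow> 0 < N.mass y"
    and sep: "\<And>x x'. x \<in> S \<Longrightarrow> x' \<in> S \<Longrightarrow> dX x x' = 0 \<longleftrightarrow> x = x'"
      "\<And>y y'. y \<in> T \<Longrightarrow> y' \<in> T \<Longrightarrow> dY y y' = 0 \<longleftrightarrow> y = y'"
    and nonneg: "\<And>x x'. 0 \<le> dX x x'" "\<And>y y'. 0 \<le> dY y y'"
  shows "PGW lam p q dX M dY N = 0 \<longleftrightarrow> strongly_isomorphic dX M dY N"
proof -
  let ?F = "pgw_sum lam p (\<lambda>x x'. dX x x' powr q) S (\<lambda>y y'. dY y y' powr q) T"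
  note fin = M.finite_space N.finite_space and mass = M.sum_mass N.sum_mass
  \<comment> \<open>The cost compares \<open>q\<close>-th powers of distances; this recovers the
    isometry itself.\<close>
  have powr_inj: "s powr q = t powr q \<longleftrightarrow> s = t" if "0 \<le> s" "0 \<le> t" for s t :: real
  proof
    assume "s powr q = t powr q"
    then have "(s powr q) powr (1 / q) = (t powr q) powr (1 / q)" by simp
    with that p(2) show "s = t" by (simp add: powr_powr)
  qed simp
  \<comment> \<open>Discrete measures are compared on singletons, and by surjectivity each of these
    is some \<open>{f x}\<close>, with the single preimage \<open>x\<close>.\<close>
  have pushforward: "distr M N f = N \<longleftrightarrow> (\<forall>x\<in>S. N.mass (f x) = M.mass x)" if f: "bij_betw f S T" for f
  proof -
    have fT: "f \<in> measurable M N"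
      using f by (auto simp: measurable_def M.sets_eq_Pow bij_betw_def)
    have em: "emeasure (distr M N f) {f x} = ennreal (M.mass x)" if "x \<in> S" for x
    proof -
      have "f -` {f x} \<inter> S = {x}" using f that by (auto simp: bij_betw_def inj_on_def)
      then show ?thesis
        using fT f that by (subst emeasure_distr) (auto simp: N.sets_eq_Pow bij_betw_def M.emeasure_eq_measure)
    qed
    have "distr M N f = N \<longleftrightarrow> (\<forall>y\<in>T. emeasure (distr M N f) {y} = emeasure N {y})"
      using measure_eqI_finite[of "distr M N f" T N] N.finite_space by (auto simp: N.sets_eq_Pow)
    also have "\<dots> \<longleftrightarrow> (\<forall>x\<in>S. emeasure (distr M N f) {f x} = emeasure N {f x})"
      unfolding bij_betw_imp_surj_on[OF f, symmetric] by simp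
    also have "\<dots> \<longleftrightarrow> (\<forall>x\<in>S. N.mass (f x) = M.mass x)"
      by (auto simp: em N.emeasure_eq_measure)
    finally show ?thesis .
  qed
  show ?thesis
  proof
    assume "PGW lam p q dX M dY N = 0"
    moreover obtain w where w: "sub_coupling S M.mass T N.mass w"
        "PGW lam p q dX M dY N = ?F w powr (1 / p)"
      by (rule PGW_attained)
    ultimately have zero: "?F w = 0" by simp
    obtain f where f: "bij_betw f S T"
        "\<And>x x'. x \<in> S \<Longrightarrow> x' \<in> S \<Longrightarrow> dY (f x) (f x') powr q = dX x x' powr q"
        "\<And>x. x \<in> S \<Longrightarrow> N.mass (f x) = M.mass x"
      by (rule pgw_sum_eq_0_imp_isomorphic[OF w(1) fin mass lam pos _ _ zero]) (use sep in auto)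
    have "f \<in> measurable M N"
      using f(1) by (auto simp: measurable_def M.sets_eq_Pow bij_betw_def)
    then show "strongly_isomorphic dX M dY N"
      unfolding strongly_isomorphic_def
      using f pushforward[OF f(1)] nonneg by (intro bexI[of _ f]) (auto simp: powr_inj)
  next
    assume "strongly_isomorphic dX M dY N"
    then obtain f where f: "bij_betw f S T" "\<And>x x'. x \<in> S \<Longrightarrow> x' \<in> S \<Longrightarrow> dY (f x) (f x') = dX x x'"
        "distr M N f = N"
      unfolding strongly_isomorphic_def by blast
    obtain w where w: "sub_coupling S M.mass T N.mass w" "?F w = 0"
      by (rule isomorphic_imp_pgw_sum_eq_0[OF fin mass lam _ f(1),
            where \<delta> = "\<lambda>x x'. dX x x' powr q" and \<epsilon> = "\<lambda>y y'. dY y y' powr q" and p = p])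
        (use f pushforward[OF f(1)] in auto)
    from PGW_le[OF w(1) p(1), of lam q dX dY] lam w(2) show "PGW lam p q dX M dY N = 0"
      by (simp add: PGW_def)
  qed
qed

end

text \<open>Transposing an optimal matrix preserves its cost. One inequality suffices, as symmetry
  follows by exchanging the spaces.\<close>

lemma PGW_commute_le:
  assumes "finite_prob_space M" "finite_prob_space N" "1 \<le> p" "0 \<le> lam"
  shows "PGW lam p q dY N dX M \<le> PGW lam p q dX M dY N"
proof -
  interpret MN: finite_prob_pair M N using assms by (simp add: finite_prob_pair_def)
  interpret NM: finite_prob_pair N M using assms by (simp add: finite_prob_pair_def)
  obtain w where w: "sub_coupling (space M) MN.M.mass (space N) MN.N.mass w"
    "PGW lam p q dX M dY N = pgw_sum lam p (\<lambda>x x'. dX x x' powr q) (space M) (\<lambda>y y'. dY y y' powr q) (space N) w powr (1 / p)"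
    by (rule MN.PGW_attained)
  from NM.PGW_le[OF sub_coupling_swap[OF w(1)] assms(3,4), of q dY dX] show ?thesis
    unfolding pgw_sum_swap w(2) .
qed

text \<open>Optimal matrices for the two outer terms are glued along \<open>N\<close>. Positive
  masses in \<open>N\<close> are required because the gluing divides by them.\<close>

lemma PGW_triangle:
  assumes "finite_prob_space M" "finite_prob_space N" "finite_prob_space L" "1 \<le> p" "0 \<le> lam"
    and pos: "\<And>y. y \<in> space N \<Longrightarrow> 0 < measure N {y}"
  shows "PGW lam p q dX M dZ L \<le> PGW lam p q dX M dY N + PGW lam p q dY N dZ L"
proof -
  interpret MN: finite_prob_pair M N using assms by (simp add: finite_prob_pair_def)
  interpret NL: finite_prob_pair N L using assms by (simp add: finite_prob_pair_def)
  interpret OL: finite_prob_pair M L using assms by (simp add: finite_prob_pair_def)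
  obtain u where u: "sub_coupling (space M) MN.M.mass (space N) MN.N.mass u"
    "PGW lam p q dX M dY N = pgw_sum lam p (\<lambda>x x'. dX x x' powr q) (space M) (\<lambda>y y'. dY y y' powr q) (space N) u powr (1 / p)"
    by (rule MN.PGW_attained)
  obtain v where v: "sub_coupling (space N) MN.N.mass (space L) NL.N.mass v"
    "PGW lam p q dY N dZ L = pgw_sum lam p (\<lambda>y y'. dY y y' powr q) (space N) (\<lambda>z z'. dZ z z' powr q) (space L) v powr (1 / p)"
    by (rule NL.PGW_attained)
  obtain w where w: "sub_coupling (space M) MN.M.mass (space L) NL.N.mass w"
    "pgw_sum lam p (\<lambda>x x'. dX x x' powr q) (space M) (\<lambda>z z'. dZ z z' powr q) (space L) w powr (1 / p)
      \<le> PGW lam p q dX M dY N + PGW lam p q dY N dZ L"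
    unfolding u(2) v(2)
    by (rule pgw_sum_triangle[OF MN.M.finite_space MN.N.finite_space NL.N.finite_space
          MN.M.sum_mass MN.N.sum_mass NL.N.sum_mass _ pos _ assms(4,5) u(1) v(1)]) auto
  from OL.PGW_le[OF w(1) assms(4,5), of q dX dZ] w(2) show ?thesis by linarith
qed

subsection \<open>Component spaces of Gaussian mixtures\<close>

text \<open>Written as a pushforward of the weights on indices, the set function passed to
  \<open>measure_of\<close> is seen to be a measure, and its values can be computed.\<close>

lemma component_measure_eq_distr:
  "component_measure \<mu> = distr (point_measure {..<ncomps \<mu>} (\<lambda>i. ennreal (weight \<mu> i)))
     (count_space (component_space \<mu>)) (component \<mu>)" (is "_ = ?P")
proof -
  have f: "component \<mu> \<in> measurable (point_measure {..<ncomps \<mu>} (\<lambda>i. ennreal (weight \<mu> i)))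
      (count_space (component_space \<mu>))"
    by (auto simp: component_space_def)
  have "(\<Sum>i<ncomps \<mu>. ennreal (weight \<mu> i) * indicator A (component \<mu> i)) = emeasure ?P A"
    if "A \<subseteq> component_space \<mu>" for A
  proof -
    have "emeasure ?P A = (\<Sum>i\<in>component \<mu> -` A \<inter> {..<ncomps \<mu>}. ennreal (weight \<mu> i))"
      using that by (subst emeasure_distr[OF f])
        (auto simp: space_point_measure emeasure_point_measure_finite)
    also have "\<dots> = (\<Sum>i<ncomps \<mu>. ennreal (weight \<mu> i) * indicator A (component \<mu> i))"
      by (intro sum.mono_neutral_cong_left) (auto simp: indicator_def)
    finally show ?thesis ..
  qed
  then have "component_measure \<mu> = measure_of (space ?P) (sets ?P) (emeasure ?P)"
    unfolding component_measure_def space_distr sets_distr space_count_space sets_count_space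
    by (intro measure_of_eq) (auto simp: sigma_algebra.sigma_sets_eq[OF sigma_algebra_Pow])
  then show ?thesis by (simp only: measure_of_of_measure)
qed

lemma component_measure_gaussian_mixture:
  assumes "gaussian_mixture \<mu>"
  shows "finite_prob_space (component_measure \<mu>)"
    and "space (component_measure \<mu>) = component \<mu> ` {..<ncomps \<mu>}"
    and "i < ncomps \<mu> \<Longrightarrow> 0 < measure (component_measure \<mu>) {component \<mu> i}"
proof -
  have pos: "\<And>i. i < ncomps \<mu> \<Longrightarrow> 0 < weight \<mu> i" and one: "(\<Sum>i<ncomps \<mu>. weight \<mu> i) = 1"
    and inj: "inj_on (component \<mu>) {..<ncomps \<mu>}"
    using assms by (auto simp: gaussian_mixture_def)
  show space: "space (component_measure \<mu>) = component \<mu> ` {..<ncomps \<mu>}"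
    by (simp add: component_measure_eq_distr component_space_def)
  have sets: "sets (component_measure \<mu>) = Pow (space (component_measure \<mu>))"
    by (simp add: component_measure_eq_distr)
  have em: "emeasure (component_measure \<mu>) A = (\<Sum>i\<in>component \<mu> -` A \<inter> {..<ncomps \<mu>}. ennreal (weight \<mu> i))"
    if "A \<subseteq> component_space \<mu>" for A
    unfolding component_measure_eq_distr using that
    by (subst emeasure_distr) (auto simp: space_point_measure emeasure_point_measure_finite component_space_def)
  show "finite_prob_space (component_measure \<mu>)"
  proof (intro finite_prob_space.intro finite_prob_space_axioms.intro prob_spaceI)
    have "component \<mu> -` component_space \<mu> \<inter> {..<ncomps \<mu>} = {..<ncomps \<mu>}"
      by (auto simp: component_space_def)
    then have "emeasure (component_measure \<mu>) (component_space \<mu>) = ennreal (\<Sum>i<ncomps \<mu>. weight \<mu> i)"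
      using pos by (subst em) (auto intro!: sum_ennreal less_imp_le)
    then show "emeasure (component_measure \<mu>) (space (component_measure \<mu>)) = 1"
      unfolding one space by (simp add: component_space_def)
  qed (simp_all add: sets, simp add: space)
  show "0 < measure (component_measure \<mu>) {component \<mu> i}" if "i < ncomps \<mu>"
  proof -
    \<comment> \<open>Components are pairwise distinct, so an atom carries the weight of a single
      index.\<close>
    have "component \<mu> -` {component \<mu> i} \<inter> {..<ncomps \<mu>} = {i}"
      using inj that by (auto simp: inj_on_def)
    then have "emeasure (component_measure \<mu>) {component \<mu> i} = ennreal (weight \<mu> i)"
      using that by (subst em) (auto simp: component_space_def)
    then show ?thesis using pos[OF that] by (simp add: measure_def)
  qed
qed

theorem theorem5p1:
  fixes p q lam :: real
    and \<mu> :: "(real ^ 'd) mixture" and \<nu> :: "(real ^ 'e) mixture"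
  assumes "1 \<le> p" and "1 \<le> q" and "0 < lam"
    and "gaussian_mixture \<mu>" and "gaussian_mixture \<nu>"
  shows
    "(\<exists>\<gamma>\<in>partial_couplings (component_measure \<mu>) (component_measure \<nu>).
        (\<forall>\<gamma>'\<in>partial_couplings (component_measure \<mu>) (component_measure \<nu>).
           pgw_objective lam p q W2 (component_measure \<mu>) W2 (component_measure \<nu>) \<gamma>
           \<le> pgw_objective lam p q W2 (component_measure \<mu>) W2 (component_measure \<nu>) \<gamma>')
        \<and> PMGW lam p q \<mu> \<nu> =
            pgw_objective lam p q W2 (component_measure \<mu>) W2 (component_measure \<nu>) \<gamma> powr (1 / p))
     \<and> (0 \<le> PMGW lam p q \<mu> \<nu>
        \<and> PMGW lam p q \<mu> \<nu> = PMGW lam p q \<nu> \<mu>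
        \<and> (\<forall>\<xi> :: (real ^ 'f) mixture. gaussian_mixture \<xi> \<longrightarrow>
             PMGW lam p q \<mu> \<xi> \<le> PMGW lam p q \<mu> \<nu> + PMGW lam p q \<nu> \<xi>)
        \<and> (PMGW lam p q \<mu> \<nu> = 0 \<longleftrightarrow>
             strongly_isomorphic W2 (component_measure \<mu>) W2 (component_measure \<nu>)))
     \<and> (Max {\<bar>W2 (component \<mu> i) (component \<mu> k) powr q
              - W2 (component \<nu> j) (component \<nu> l) powr q\<bar> powr p | i k j l.
              i < ncomps \<mu> \<and> k < ncomps \<mu> \<and> j < ncomps \<nu> \<and> l < ncomps \<nu>} \<le> lam
          \<longrightarrow> PMGW lam p q \<mu> \<nu> = MGW p q \<mu> \<nu>)
     \<and> ((\<lambda>t. PMGW t p q \<mu> \<nu>) \<longlongrightarrow> MGW p q \<mu> \<nu>) at_top"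
proof -
  let ?M = "component_measure \<mu>" and ?N = "component_measure \<nu>"
  let ?c = "\<lambda>i k j l. \<bar>W2 (component \<mu> i) (component \<mu> k) powr q
              - W2 (component \<nu> j) (component \<nu> l) powr q\<bar> powr p"
  let ?costs = "{?c i k j l | i k j l.
              i < ncomps \<mu> \<and> k < ncomps \<mu> \<and> j < ncomps \<nu> \<and> l < ncomps \<nu>}"
  note M = component_measure_gaussian_mixture[OF assms(4)]
    and N = component_measure_gaussian_mixture[OF assms(5)]
  interpret finite_prob_pair ?M ?N using M(1) N(1) by (simp add: finite_prob_pair_def)
  have pos: "0 < measure ?M {x}" if "x \<in> space ?M" for x using that M(2,3) by auto
  have pos': "0 < measure ?N {y}" if "y \<in> space ?N" for y using that N(2,3) by auto
  have sep: "W2 x x' = 0 \<longleftrightarrow> x = x'" if "x \<in> space ?M" "x' \<in> space ?M" for x x'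
    using that assms(4) unfolding M(2) by (intro gaussian_W2_eq_0_iff) (auto simp: gaussian_mixture_def)
  have sep': "W2 y y' = 0 \<longleftrightarrow> y = y'" if "y \<in> space ?N" "y' \<in> space ?N" for y y'
    using that assms(5) unfolding N(2) by (intro gaussian_W2_eq_0_iff) (auto simp: gaussian_mixture_def)
  \<comment> \<open>Stated for every such \<open>t\<close>, so that it yields both the equality at
    \<open>lam\<close> and the limit.\<close>
  have balanced: "PMGW t p q \<mu> \<nu> = MGW p q \<mu> \<nu>" if t: "Max ?costs \<le> t" for t
    unfolding PMGW_def MGW_def
  proof (rule PGW_eq_GW)
    fix x x' y y' assume "x \<in> space ?M" "x' \<in> space ?M" "y \<in> space ?N" "y' \<in> space ?N"
    then obtain i k j l where ij: "i < ncomps \<mu>" "k < ncomps \<mu>" "j < ncomps \<nu>" "l < ncomps \<nu>"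
      and eq: "x = component \<mu> i" "x' = component \<mu> k" "y = component \<nu> j" "y' = component \<nu> l"
      unfolding M(2) N(2) by blast
    have "?costs = (\<lambda>(i, k, j, l). ?c i k j l) `
        ({..<ncomps \<mu>} \<times> {..<ncomps \<mu>} \<times> {..<ncomps \<nu>} \<times> {..<ncomps \<nu>})"
      by force
    then have "finite ?costs" by simp
    then have "?c i k j l \<le> Max ?costs" using ij by (intro Max_ge) blast+
    \<comment> \<open>Nonnegative costs give \<open>t \<ge> 0\<close>, which turns the bound
      \<open>t\<close> into the bound \<open>2 * t\<close>.\<close>
    moreover have "0 \<le> ?c i k j l" by simp
    ultimately show "\<bar>W2 x x' powr q - W2 y y' powr q\<bar> powr p \<le> 2 * t"
      unfolding eq using t by linarith
  qed
  have "\<exists>\<gamma>\<in>partial_couplings ?M ?N.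
      (\<forall>\<gamma>'\<in>partial_couplings ?M ?N. pgw_objective lam p q W2 ?M W2 ?N \<gamma> \<le> pgw_objective lam p q W2 ?M W2 ?N \<gamma>')
      \<and> PMGW lam p q \<mu> \<nu> = pgw_objective lam p q W2 ?M W2 ?N \<gamma> powr (1 / p)"
    by (rule PGW_minimizer[of lam p q W2 W2]) (auto simp: PMGW_def PGW_def)
  moreover have "0 \<le> PMGW lam p q \<mu> \<nu>" by (simp add: PMGW_def PGW_def)
  moreover have "PMGW lam p q \<mu> \<nu> = PMGW lam p q \<nu> \<mu>"
    unfolding PMGW_def using M(1) N(1) assms(1,3) by (intro antisym PGW_commute_le) auto
  moreover have "PMGW lam p q \<mu> \<xi> \<le> PMGW lam p q \<mu> \<nu> + PMGW lam p q \<nu> \<xi>"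
    if "gaussian_mixture \<xi>" for \<xi> :: "(real ^ 'f) mixture"
    unfolding PMGW_def
    using M(1) N(1) component_measure_gaussian_mixture(1)[OF that] assms(1,3) pos'
    by (intro PGW_triangle) auto
  moreover have "PMGW lam p q \<mu> \<nu> = 0 \<longleftrightarrow> strongly_isomorphic W2 ?M W2 ?N"
    unfolding PMGW_def
    by (rule PGW_eq_0_iff_strongly_isomorphic[OF assms(1-3) pos pos' sep sep' W2_nonneg W2_nonneg])
  moreover have "((\<lambda>t. PMGW t p q \<mu> \<nu>) \<longlongrightarrow> MGW p q \<mu> \<nu>) at_top"
    \<comment> \<open>The function of \<open>t\<close> is constant from the maximal cost
      onwards.\<close>
    by (rule tendsto_eventually) (use balanced in \<open>auto simp: eventually_at_top_linorder\<close>)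
  ultimately show ?thesis using balanced[of lam] by blast
qed

end
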